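(* Let $\mathcal M$ and $\mathcal M_m$ ($m\in\mathbb N$) be invariant subspaces of $\bigotimes_{i=1}^kF^2(H_{n_i})\otimes\mathcal E$ with $\dim\mathcal E<\infty$. If $P_{\mathcal M_m}\to P_{\mathcal M}$ in the weak operator topology as $m\to\infty$, then $$\liminf_{m\to\infty}m(\mathcal M_m)\ge m(\mathcal M).$$
   Context: All Hilbert spaces are complex; $\mathbb N=\{1,2,\ldots\}$. Fix $k\in\mathbb N$ and $(n_1,\ldots,n_k)\in\mathbb N^k$. $F^2(H_{n_i})=\mathbb C1\oplus\bigoplus_{p\ge1}H_{n_i}^{\otimes p}$ is the full Fock space of an $n_i$-dimensional Hilbert space $H_{n_i}$ with orthonormal basis $e^i_1,\ldots,e^i_{n_i}$. $\mathbb F_{n_i}^+$ is the free unital semigroup on $n_i$ generators $g_1^i,\ldots,g_{n_i}^i$ with length $|\cdot|$; for $\alpha=g^i_{j_1}\cdots g^i_{j_p}$ put $e^i_\alpha=e^i_{j_1}\otimes\cdots\otimes e^i_{j_p}$, and $e^i_\alpha=1$ for the neutral element. Let $S_{i,j}e^i_\alpha=e^i_{g^i_j\alpha}$ and $\mathbf S_{i,j}=I\otimes\cdots\otimes S_{i,j}\otimes\cdots\otimes I$ ($S_{i,j}$ in position $i$) on $\bigotimes_{i=1}^kF^2(H_{n_i})$. An invariant subspace of $\bigotimes_iF^2(H_{n_i})\otimes\mathcal E$ is a closed subspace invariant under every $\mathbf S_{i,j}\otimes I_{\mathcal E}$; $P_{\mathcal M}$ is the orthogonal projection onto $\mathcal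 M$. $P^{(i)}_q$ is the orthogonal projection of $F^2(H_{n_i})$ onto the span of all $e^i_\alpha$ with $|\alpha|=q$. The multiplicity of $\mathcal M$ is $$m(\mathcal M):=\lim_{r\to\infty}\frac1{\binom{r+k}{k}}\sum_{\substack{q_1\ge0,\ldots,q_k\ge0\\ q_1+\cdots+q_k\le r}}\frac{\mathrm{trace}\left[P_{\mathcal M}(P^{(1)}_{q_1}\otimes\cdots\otimes P^{(k)}_{q_k}\otimes I_{\mathcal E})\right]}{\mathrm{trace}\left[P^{(1)}_{q_1}\otimes\cdots\otimes P^{(k)}_{q_k}\right]}$$ (this limit exists). *)

theory Defs
  imports "HOL-Analysis.Analysis" "HOL-Library.FuncSet"
begin

section \<open>Complex inner product spaces\<close>

text \<open>
  The inner product is linear in the first and conjugate-linear in the second argument. Norm and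
  topology are those of the underlying real inner product space.
\<close>

class complex_inner = real_inner +
  fixes scaleC :: "complex \<Rightarrow> 'a \<Rightarrow> 'a" (infixr "*\<^sub>C" 75)
    and cinner :: "'a \<Rightarrow> 'a \<Rightarrow> complex"
  assumes scaleC_add_right: "c *\<^sub>C (x + y) = c *\<^sub>C x + c *\<^sub>C y"
    and scaleC_add_left: "(c + d) *\<^sub>C x = c *\<^sub>C x + d *\<^sub>C x"
    and scaleC_scaleC: "c *\<^sub>C d *\<^sub>C x = (c * d) *\<^sub>C x"
    and scaleC_of_real: "complex_of_real r *\<^sub>C x = r *\<^sub>R x"
    and cinner_add_left: "cinner (x + y) z = cinner x z + cinner y z"
    and cinner_scaleC_left: "cinner (c *\<^sub>C x) y = c * cinner x y"
    and cinner_commute: "cinner x y = cnj (cinner y x)"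
    and Re_cinner: "Re (cinner x y) = inner x y"

instantiation complex :: complex_inner
begin

definition scaleC_complex :: "complex \<Rightarrow> complex \<Rightarrow> complex"
  where "scaleC_complex c x = c * x"

definition cinner_complex :: "complex \<Rightarrow> complex \<Rightarrow> complex"
  where "cinner_complex x y = x * cnj y"

instance
  by standard (auto simp: scaleC_complex_def cinner_complex_def algebra_simps
      scaleR_conv_of_real inner_complex_def)

end

definition finite_dim_complex :: "'e::complex_inner itself \<Rightarrow> bool"
  where "finite_dim_complex _ \<longleftrightarrow>
    (\<exists>B::'e set. finite B \<and> (\<forall>x. \<exists>c. x = (\<Sum>b\<in>B. c b *\<^sub>C b)))"


section \<open>The Hilbert space of square-summable families\<close>

text \<open>
  \<open>l2 W\<close> is the Hilbert space of square-summable families over \<open>W\<close> with values in \<open>'e\<close>, i.e. the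
  Hilbert space tensor product of the scalar space over \<open>W\<close> with \<open>'e\<close> (when \<open>'e\<close> is complete, in
  particular when it is finite-dimensional). Members vanish outside \<open>W\<close>, so that equality in the
  space is equality of functions. Operators are functions whose values matter on \<open>l2 W\<close> only.
\<close>

definition l2 :: "'w set \<Rightarrow> ('w \<Rightarrow> 'e::complex_inner) set"
  where "l2 W = {f. (\<forall>w. w \<notin> W \<longrightarrow> f w = 0) \<and> (\<lambda>w. (norm (f w))\<^sup>2) summable_on W}"

definition l2_inner :: "'w set \<Rightarrow> ('w \<Rightarrow> 'e::complex_inner) \<Rightarrow> ('w \<Rightarrow> 'e) \<Rightarrow> complex"
  where "l2_inner W f g = (\<Sum>\<^sub>\<infinity>w\<in>W. cinner (f w) (g w))"

definition l2_norm :: "'w set \<Rightarrow> ('w \<Rightarrow> 'e::complex_inner) \<Rightarrow> real"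
  where "l2_norm W f = sqrt (Re (l2_inner W f f))"

definition closed_subspace :: "'w set \<Rightarrow> ('w \<Rightarrow> 'e::complex_inner) set \<Rightarrow> bool"
  where "closed_subspace W M \<longleftrightarrow>
    M \<subseteq> l2 W \<and> (\<lambda>w. 0) \<in> M \<and>
    (\<forall>f\<in>M. \<forall>g\<in>M. (\<lambda>w. f w + g w) \<in> M) \<and>
    (\<forall>c. \<forall>f\<in>M. (\<lambda>w. c *\<^sub>C f w) \<in> M) \<and>
    (\<forall>f\<in>l2 W. (\<forall>\<epsilon>>0. \<exists>g\<in>M. l2_norm W (\<lambda>w. f w - g w) < \<epsilon>) \<longrightarrow> f \<in> M)"

definition orth_proj :: "'w set \<Rightarrow> ('w \<Rightarrow> 'e::complex_inner) set \<Rightarrow> ('w \<Rightarrow> 'e) \<Rightarrow> ('w \<Rightarrow> 'e)"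
  where "orth_proj W M f = (THE g. g \<in> M \<and> (\<forall>h\<in>M. l2_inner W (\<lambda>w. f w - g w) h = 0))"

definition wot_tendsto ::
    "'w set \<Rightarrow> (nat \<Rightarrow> ('w \<Rightarrow> 'e::complex_inner) \<Rightarrow> ('w \<Rightarrow> 'e)) \<Rightarrow> (('w \<Rightarrow> 'e) \<Rightarrow> ('w \<Rightarrow> 'e)) \<Rightarrow> bool"
  where "wot_tendsto W Ts T \<longleftrightarrow>
    (\<forall>f\<in>l2 W. \<forall>g\<in>l2 W. (\<lambda>m. l2_inner W (Ts m f) g) \<longlonglongrightarrow> l2_inner W (T f) g)"

definition orthonormal_basis :: "'w set \<Rightarrow> ('w \<Rightarrow> 'e::complex_inner) set \<Rightarrow> bool"
  where "orthonormal_basis W B \<longleftrightarrow>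
    B \<subseteq> l2 W \<and>
    (\<forall>b\<in>B. \<forall>b'\<in>B. l2_inner W b b' = (if b = b' then 1 else 0)) \<and>
    (\<forall>f\<in>l2 W. (\<forall>b\<in>B. l2_inner W f b = 0) \<longrightarrow> f = (\<lambda>w. 0))"

text \<open>For trace class operators the value does not depend on the chosen orthonormal basis.\<close>

definition trace_op :: "'w set \<Rightarrow> (('w \<Rightarrow> 'e::complex_inner) \<Rightarrow> ('w \<Rightarrow> 'e)) \<Rightarrow> complex"
  where "trace_op W T = (\<Sum>\<^sub>\<infinity>b\<in>(SOME B. orthonormal_basis W B). l2_inner W (T b) b)"


section \<open>Tensor products of full Fock spaces\<close>

text \<open>
  The word $g^i_{j_1}\cdots g^i_{j_p}$ is the list \<open>[j\<^sub>1, \<dots>, j\<^sub>p]\<close> over \<open>{1..n i}\<close>. The vectors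
  $e^i_\alpha$ form an orthonormal basis of the full Fock space $F^2(H_{n_i})$, so the vectors
  $e^1_{\alpha_1}\otimes\cdots\otimes e^k_{\alpha_k}$ form one of the tensor product of the
  Fock spaces, which is thereby identified with \<open>l2 (multiwords k n)\<close> (with values in \<open>complex\<close>),
  and its tensor product with \<open>'e\<close> is \<open>l2 (multiwords k n)\<close> with values in \<open>'e\<close>.
\<close>

definition multiwords :: "nat \<Rightarrow> (nat \<Rightarrow> nat) \<Rightarrow> (nat \<Rightarrow> nat list) set"
  where "multiwords k n = (\<Pi>\<^sub>E i\<in>{1..k}. lists {1..n i})"

text \<open>
  $e^1_{\alpha_1}\otimes\cdots\otimes e^k_{\alpha_k}\otimes x$:
\<close>

definition fock_vec :: "(nat \<Rightarrow> nat list) \<Rightarrow> 'e::complex_inner \<Rightarrow> ((nat \<Rightarrow> nat list) \<Rightarrow> 'e)"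
  where "fock_vec \<alpha> x = (\<lambda>\<beta>. if \<beta> = \<alpha> then x else 0)"

text \<open>
  The operator $\mathbf S_{i,j}\otimes I$ in coordinates; \<open>creation_fock_vec\<close> below is its
  description on elementary tensors.
\<close>

definition creation ::
    "nat \<Rightarrow> nat \<Rightarrow> ((nat \<Rightarrow> nat list) \<Rightarrow> 'e::complex_inner) \<Rightarrow> ((nat \<Rightarrow> nat list) \<Rightarrow> 'e)"
  where "creation i j f = (\<lambda>\<alpha>. case \<alpha> i of
      [] \<Rightarrow> 0
    | b # \<beta> \<Rightarrow> (if b = j then f (\<alpha>(i := \<beta>)) else 0))"

lemma creation_fock_vec: "creation i j (fock_vec \<alpha> x) = fock_vec (\<alpha>(i := j # \<alpha> i)) x"
  by (rule ext) (auto simp: creation_def fock_vec_def fun_eq_iff split: list.splits)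

text \<open>$P^{(1)}_{q_1}\otimes\cdots\otimes P^{(k)}_{q_k}\otimes I$:\<close>

definition degree_proj ::
    "nat \<Rightarrow> (nat \<Rightarrow> nat) \<Rightarrow> ((nat \<Rightarrow> nat list) \<Rightarrow> 'e::complex_inner) \<Rightarrow> ((nat \<Rightarrow> nat list) \<Rightarrow> 'e)"
  where "degree_proj k q f = (\<lambda>\<alpha>. if \<forall>i\<in>{1..k}. length (\<alpha> i) = q i then f \<alpha> else 0)"

lemma degree_proj_fock_vec:
  "degree_proj k q (fock_vec \<alpha> x) =
    (if \<forall>i\<in>{1..k}. length (\<alpha> i) = q i then fock_vec \<alpha> x else (\<lambda>\<beta>. 0))"
  by (rule ext) (auto simp: degree_proj_def fock_vec_def)

definition invariant_subspace ::
    "nat \<Rightarrow> (nat \<Rightarrow> nat) \<Rightarrow> ((nat \<Rightarrow> nat list) \<Rightarrow> 'e::complex_inner) set \<Rightarrow> bool"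
  where "invariant_subspace k n M \<longleftrightarrow>
    closed_subspace (multiwords k n) M \<and>
    (\<forall>i\<in>{1..k}. \<forall>j\<in>{1..n i}. creation i j ` M \<subseteq> M)"

text \<open>
  Both traces are nonnegative reals; the one in the denominator is taken on the scalar-valued
  space, i.e. without the factor \<open>'e\<close>.
\<close>

definition subspace_multiplicity ::
    "nat \<Rightarrow> (nat \<Rightarrow> nat) \<Rightarrow> ((nat \<Rightarrow> nat list) \<Rightarrow> 'e::complex_inner) set \<Rightarrow> real"
  where "subspace_multiplicity k n M = lim (\<lambda>r.
    (1 / real ((r + k) choose k)) *
    (\<Sum>q \<in> {q \<in> {1..k} \<rightarrow>\<^sub>E UNIV. (\<Sum>i\<in>{1..k}. q i) \<le> r}.
      Re (trace_op (multiwords k n)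
            (\<lambda>f. orth_proj (multiwords k n) M (degree_proj k q f))) /
      Re (trace_op (multiwords k n)
            (degree_proj k q :: ((nat \<Rightarrow> nat list) \<Rightarrow> complex) \<Rightarrow> _))))"

end

theory Submission imports Defs begin

text \<open>
  Write $a_M(q)$ for the $q$-th quotient of traces. If $S$ is a creation operator, $v$ a vector and
  $p = P_M v$, then $S p \in M$, and testing $S v$ against $S p$ gives
  $\|P_M S v\| \ge \|p\|$. Expanding the traces in elementary tensors, this makes $a_M$ nondecreasing
  in each $q_i$; since it is also bounded, its averages over the simplices $q_1 + \cdots + q_k \le r$
  converge to its supremum, so $m(M) = \sup_q a_M(q)$. Each $a_M(q)$ is a finite sum of matrix
  coefficients of $P_M$ and hence continuous in the weak operator topology, and a supremum
  of continuous functions is lower semicontinuous.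
\<close>

section \<open>Complex inner products\<close>

text \<open>\<open>trace_op\<close> sums over a basis picked by \<open>SOME\<close>, of which only
  orthonormality and maximality are known. Expanding a trace in elementary tensors therefore needs
  Parseval's identity for every such basis, and through it the projection theorem. The sets
  \<open>l2 W\<close> carry no norm as a type, and \<open>complex_inner\<close> does not include
  completeness; so the Hilbert space theory is developed for complete subspaces of any type in that
  class and then carried over to \<open>l2 W\<close>. Finite dimension of the coefficient space
  supplies both the completeness and the bound on the quotients.

  The normalization is what makes monotonicity work: raising q_i by one multiplies the number of
  words by n_i, which is exactly the number of creation operators in position i, and each of them
  preserves the norm inequality. Small values of the quotient at low degrees do not lower the limit,
  because the translate of a large simplex by a fixed p fills a proportion tending to 1 of the
  slightly larger simplex that contains it.\<close>

lemma cinner_add_right: "cinner x (y + z) = cinner x y + cinner x (z::'a::complex_inner)"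
  by (metis cinner_add_left cinner_commute complex_cnj_add)

lemma cinner_scaleC_right: "cinner x (c *\<^sub>C y) = cnj c * cinner x (y::'a::complex_inner)"
  by (metis cinner_commute cinner_scaleC_left complex_cnj_mult)

lemma cinner_zero_left [simp]: "cinner 0 (x::'a::complex_inner) = 0"
  using cinner_add_left[of 0 0 x] by simp

lemma cinner_zero_right [simp]: "cinner (x::'a::complex_inner) 0 = 0"
  using cinner_add_right[of x 0 0] by simp

lemma cinner_diff_left: "cinner (x - y) z = cinner x z - cinner y (z::'a::complex_inner)"
  using cinner_add_left[of "x - y" y z] by simp

lemma cinner_sum_left: "cinner (\<Sum>a\<in>A. f a) y = (\<Sum>a\<in>A. cinner (f a) (y::'a::complex_inner))"
  by (induction A rule: infinite_finite_induct) (simp_all add: cinner_add_left)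

lemma cinner_sum_right: "cinner y (\<Sum>a\<in>A. f a) = (\<Sum>a\<in>A. cinner (y::'a::complex_inner) (f a))"
  by (induction A rule: infinite_finite_induct) (simp_all add: cinner_add_right)

lemma cinner_self: "cinner x x = of_real ((norm (x::'a::complex_inner))\<^sup>2)"
proof -
  have "Im (cinner x x) = 0"
    using arg_cong[OF cinner_commute[of x x], of Im] by simp
  then show ?thesis
    by (simp add: complex_eq_iff Re_cinner power2_norm_eq_inner)
qed

lemma scaleC_zero_left [simp]: "0 *\<^sub>C (x::'a::complex_inner) = 0"
  using scaleC_of_real[of 0 x] by simp

lemma scaleC_zero_right [simp]: "c *\<^sub>C (0::'a::complex_inner) = 0"
  using scaleC_add_right[of c 0 "0::'a"] by simp

lemma scaleC_one [simp]: "1 *\<^sub>C (x::'a::complex_inner) = x"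
  using scaleC_of_real[of 1 x] by simp

lemma scaleC_diff_left: "(c - d) *\<^sub>C (x::'a::complex_inner) = c *\<^sub>C x - d *\<^sub>C x"
  using scaleC_add_left[of "c - d" d x] by (simp add: algebra_simps)

lemma scaleC_minus1: "(-1) *\<^sub>C (x::'a::complex_inner) = - x"
  using scaleC_of_real[of "-1" x] by simp

lemma scaleC_sum_right: "c *\<^sub>C (\<Sum>a\<in>A. f a) = (\<Sum>a\<in>A. c *\<^sub>C (f a :: 'a::complex_inner))"
  by (induction A rule: infinite_finite_induct) (simp_all add: scaleC_add_right)

lemma scaleC_sum_left: "(\<Sum>a\<in>A. f a) *\<^sub>C (x :: 'a::complex_inner) = (\<Sum>a\<in>A. f a *\<^sub>C x)"
  by (induction A rule: infinite_finite_induct) (simp_all add: scaleC_add_left)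

lemma norm_scaleC: "norm (c *\<^sub>C (x::'a::complex_inner)) = cmod c * norm x"
proof -
  have "complex_of_real ((norm (c *\<^sub>C x))\<^sup>2) = of_real ((cmod c * norm x)\<^sup>2)"
    unfolding cinner_self[symmetric] cinner_scaleC_left cinner_scaleC_right
    using complex_norm_square[of c] by (simp add: cinner_self power_mult_distrib)
  then show ?thesis
    by (simp only: of_real_eq_iff) (simp add: power2_eq_iff_nonneg)
qed

text \<open>Multiplying \<open>x\<close> by a complex number \<open>c\<close> of modulus 1 rotates
  the inner product onto the nonnegative reals, where the real Cauchy-Schwarz inequality
  applies.\<close>

lemma norm_cinner_le: "cmod (cinner x y) \<le> norm x * norm (y::'a::complex_inner)"
proof (cases "cinner x y = 0")
  case False
  define c where "c = cnj (sgn (cinner x y))"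
  have c: "cmod c = 1" using False by (simp add: c_def norm_sgn)
  have "cmod (cinner x y) = Re (cinner (c *\<^sub>C x) y)"
  proof -
    let ?z = "cinner x y"
    have "cnj (sgn ?z) * ?z = (?z * cnj ?z) / of_real (cmod ?z)" by (simp add: sgn_eq mult.commute)
    also have "\<dots> = of_real (cmod ?z)"
      using False by (simp add: complex_norm_square[symmetric] power2_eq_square)
    finally show ?thesis by (simp add: cinner_scaleC_left c_def)
  qed
  also have "\<dots> \<le> norm x * norm y"
    using norm_cauchy_schwarz[of "c *\<^sub>C x" y] c by (simp add: Re_cinner norm_scaleC)
  finally show ?thesis .
qed simp

lemma bounded_linear_scaleC: "bounded_linear (\<lambda>x::'a::complex_inner. c *\<^sub>C x)"
proof (rule bounded_linear_intro[of _ "cmod c"])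
  fix r and x :: 'a
  show "c *\<^sub>C (r *\<^sub>R x) = r *\<^sub>R (c *\<^sub>C x)"
    by (simp add: scaleC_of_real[symmetric] scaleC_scaleC mult.commute)
qed (simp_all add: scaleC_add_right norm_scaleC)

section \<open>Complex subspaces\<close>

text \<open>Purely algebraic: the topological half of "closed subspace" enters separately as
  completeness of the set, which suits an ambient space that may itself be incomplete.\<close>

definition csubspace :: "'a::complex_inner set \<Rightarrow> bool"
  where "csubspace M \<longleftrightarrow> 0 \<in> M \<and> (\<forall>x\<in>M. \<forall>y\<in>M. x + y \<in> M) \<and> (\<forall>c. \<forall>x\<in>M. c *\<^sub>C x \<in> M)"

lemma csubspaceD:
  assumes "csubspace M"
  shows csubspace_0: "0 \<in> M"
    and csubspace_add: "x \<in> M \<Longrightarrow> y \<in> M \<Longrightarrow> x + y \<in> M"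
    and csubspace_scaleC: "x \<in> M \<Longrightarrow> c *\<^sub>C x \<in> M"
    and csubspace_scaleR: "x \<in> M \<Longrightarrow> r *\<^sub>R x \<in> M"
    and csubspace_diff: "x \<in> M \<Longrightarrow> y \<in> M \<Longrightarrow> x - y \<in> M"
proof -
  show "0 \<in> M" "x \<in> M \<Longrightarrow> y \<in> M \<Longrightarrow> x + y \<in> M" and sc: "x \<in> M \<Longrightarrow> c *\<^sub>C x \<in> M" for x y c
    using assms by (auto simp: csubspace_def)
  show "x \<in> M \<Longrightarrow> r *\<^sub>R x \<in> M"
    using assms by (auto simp: csubspace_def scaleC_of_real[symmetric])
  show "x \<in> M \<Longrightarrow> y \<in> M \<Longrightarrow> x - y \<in> M"
    using assms unfolding csubspace_def by (metis add_uminus_conv_diff scaleC_minus1)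
qed

lemma csubspace_sum:
  assumes "csubspace M" "\<And>a. a \<in> A \<Longrightarrow> f a \<in> M"
  shows "(\<Sum>a\<in>A. f a) \<in> M"
  using assms(2)
  by (induction A rule: infinite_finite_induct) (auto intro: csubspaceD[OF assms(1)])

lemma parallelogram:
  fixes x y :: "'a::real_inner"
  shows "(norm (x + y))\<^sup>2 + (norm (x - y))\<^sup>2 = 2 * (norm x)\<^sup>2 + 2 * (norm y)\<^sup>2"
  by (simp add: power2_norm_eq_inner inner_add inner_diff inner_commute)

text \<open>A minimizing sequence in \<open>M\<close> is Cauchy, so completeness of \<open>M\<close>
  gives a limit at the minimal distance.\<close>

lemma ex_nearest_point:
  fixes M :: "'a::complex_inner set"
  assumes M: "csubspace M" and "complete M"
  obtains g where "g \<in> M" "\<And>h. h \<in> M \<Longrightarrow> norm (x - g) \<le> norm (x - h)"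
proof -
  define d where "d = (INF h\<in>M. norm (x - h))"
  have ne: "M \<noteq> {}" using csubspace_0[OF M] by blast
  have bdd: "bdd_below ((\<lambda>h. norm (x - h)) ` M)" by (rule bdd_belowI[of _ 0]) auto
  have d_le: "d \<le> norm (x - h)" if "h \<in> M" for h
    unfolding d_def using bdd that by (rule cINF_lower)
  have d0: "0 \<le> d" unfolding d_def using ne by (rule cINF_greatest) simp
  have "\<exists>h\<in>M. norm (x - h) < d + inverse (real (Suc n))" for n
    using cINF_less_iff[OF ne bdd, of "d + inverse (real (Suc n))"] unfolding d_def[symmetric] by simp
  then obtain u where u: "\<And>n. u n \<in> M" "\<And>n. norm (x - u n) < d + inverse (real (Suc n))"
    by metis
  have lim: "(\<lambda>n. norm (x - u n)) \<longlonglongrightarrow> d"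
  proof (rule tendsto_sandwich[where f = "\<lambda>n. d"])
    show "(\<lambda>n. d + inverse (real (Suc n))) \<longlonglongrightarrow> d"
      by (rule LIMSEQ_inverse_real_of_nat_add)
    show "\<forall>\<^sub>F n in sequentially. norm (x - u n) \<le> d + inverse (real (Suc n))"
      using u(2) by (intro always_eventually allI less_imp_le)
  qed (simp_all add: d_le u(1))
  \<comment> \<open>The midpoint of two almost nearest points lies in M, so the parallelogram law bounds their distance.\<close>
  have key: "(norm (u m - u n))\<^sup>2 \<le> 2 * (norm (x - u m))\<^sup>2 + 2 * (norm (x - u n))\<^sup>2 - 4 * d\<^sup>2" for m n
  proof -
    have "(1/2) *\<^sub>R (u m + u n) \<in> M"
      by (intro csubspaceD[OF M] u)
    then have "d \<le> norm (x - (1/2) *\<^sub>R (u m + u n))" by (rule d_le)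
    also have "x - (1/2) *\<^sub>R (u m + u n) = (1/2) *\<^sub>R ((x - u m) + (x - u n))"
      by (simp add: algebra_simps) (simp add: scaleR_left_distrib[symmetric])
    finally have "2 * d \<le> norm ((x - u m) + (x - u n))" by simp
    then have "(2 * d)\<^sup>2 \<le> (norm ((x - u m) + (x - u n)))\<^sup>2"
      using d0 by (intro power_mono) auto
    moreover have "(x - u m) - (x - u n) = - (u m - u n)" by simp
    ultimately show ?thesis
      using parallelogram[of "x - u m" "x - u n"] by (simp add: power_mult_distrib norm_minus_commute)
  qed
  have "Cauchy u"
  proof (rule CauchyI)
    fix e :: real assume e: "e > 0"
    have "(\<lambda>n. (norm (x - u n))\<^sup>2) \<longlonglongrightarrow> d\<^sup>2" by (intro tendsto_power lim)
    then have "eventually (\<lambda>n. (norm (x - u n))\<^sup>2 < d\<^sup>2 + e\<^sup>2 / 4) sequentially"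
      using e by (intro order_tendstoD) auto
    then obtain N where N: "\<And>n. n \<ge> N \<Longrightarrow> (norm (x - u n))\<^sup>2 < d\<^sup>2 + e\<^sup>2 / 4"
      by (auto simp: eventually_sequentially)
    have "norm (u m - u n) < e" if "m \<ge> N" "n \<ge> N" for m n
    proof -
      have "(norm (u m - u n))\<^sup>2 < e\<^sup>2" using key[of m n] N[OF that(1)] N[OF that(2)] by linarith
      then show ?thesis using e by (simp add: power_less_imp_less_base)
    qed
    then show "\<exists>N. \<forall>m\<ge>N. \<forall>n\<ge>N. norm (u m - u n) < e" by blast
  qed
  with assms(2) u(1) obtain g where g: "g \<in> M" "u \<longlonglongrightarrow> g" unfolding complete_def by blast
  have "(\<lambda>n. norm (x - u n)) \<longlonglongrightarrow> norm (x - g)" by (intro tendsto_intros g)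
  with lim have "norm (x - g) = d" using LIMSEQ_unique by blast
  with g d_le show ?thesis using that by auto
qed

text \<open>At a nearest point the residual is orthogonal to \<open>M\<close>: otherwise moving
  \<open>g\<close> by the component of the residual along some \<open>h\<close> in \<open>M\<close>
  would, by Pythagoras, come strictly closer to \<open>x\<close>.\<close>

lemma ex_orthogonal_projection:
  fixes M :: "'a::complex_inner set"
  assumes M: "csubspace M" and "complete M"
  obtains g where "g \<in> M" "\<And>h. h \<in> M \<Longrightarrow> cinner (x - g) h = 0"
proof -
  obtain g where g: "g \<in> M" and le: "\<And>h. h \<in> M \<Longrightarrow> norm (x - g) \<le> norm (x - h)"
    using ex_nearest_point[OF assms] by blast
  have "cinner (x - g) h = 0" if h: "h \<in> M" for h
  proof (rule ccontr)
    assume nz: "cinner (x - g) h \<noteq> 0"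
    then have h0: "h \<noteq> 0" by auto
    define c where "c = cinner (x - g) h / cinner h h"
    let ?r = "x - g"
    have hh: "cinner h h \<noteq> 0" using h0 by (simp add: cinner_self)
    have "g + c *\<^sub>C h \<in> M" by (intro csubspaceD[OF M] g h)
    then have "norm ?r \<le> norm (?r - c *\<^sub>C h)" using le[of "g + c *\<^sub>C h"] by (simp add: algebra_simps)
    then have "(norm ?r)\<^sup>2 \<le> (norm (?r - c *\<^sub>C h))\<^sup>2" by (intro power_mono) auto
    moreover have orth: "cinner (?r - c *\<^sub>C h) (c *\<^sub>C h) = 0"
      using hh by (simp add: c_def cinner_diff_left cinner_scaleC_left cinner_scaleC_right)
    have "(norm ?r)\<^sup>2 = (norm (?r - c *\<^sub>C h))\<^sup>2 + (norm (c *\<^sub>C h))\<^sup>2"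
    proof -
      have "inner (?r - c *\<^sub>C h) (c *\<^sub>C h) = 0" using orth Re_cinner[of "?r - c *\<^sub>C h" "c *\<^sub>C h"] by simp
      then show ?thesis by (simp add: power2_norm_eq_inner inner_diff inner_commute algebra_simps)
    qed
    ultimately have "norm (c *\<^sub>C h) = 0" by simp
    then show False using nz h0 hh by (simp add: norm_scaleC c_def)
  qed
  with g that show ?thesis by blast
qed

section \<open>Orthonormal sets\<close>

definition orthonormal :: "'a::complex_inner set \<Rightarrow> bool"
  where "orthonormal B \<longleftrightarrow> (\<forall>b\<in>B. \<forall>b'\<in>B. cinner b b' = (if b = b' then 1 else 0))"

lemma orthonormal_norm: "orthonormal B \<Longrightarrow> b \<in> B \<Longrightarrow> norm b = 1"
  using cinner_self[of b] Re_cinner[of b b] by (simp add: orthonormal_def norm_eq_sqrt_inner)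

lemma cinner_orthonormal_sum:
  assumes "orthonormal B" "finite F" "F \<subseteq> B" "b \<in> F"
  shows "cinner (\<Sum>a\<in>F. c a *\<^sub>C a) b = c b"
proof -
  have "cinner (\<Sum>a\<in>F. c a *\<^sub>C a) b = (\<Sum>a\<in>F. if a = b then c a else 0)"
    unfolding cinner_sum_left cinner_scaleC_left
  proof (intro sum.cong refl)
    fix a assume "a \<in> F"
    then have "cinner a b = (if a = b then 1 else 0)" using assms unfolding orthonormal_def by blast
    then show "c a * cinner a b = (if a = b then c a else 0)" by simp
  qed
  with assms show ?thesis by simp
qed

text \<open>The partial expansion is orthogonal to the remainder, so Pythagoras applies. In this
  form the inequality says that the partial expansion maps are contractions, uniformly in
  \<open>F\<close>, which is what the passage to limits below uses.\<close>

lemma bessel: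
  assumes "orthonormal B" "finite F" "F \<subseteq> B"
  shows "norm (\<Sum>b\<in>F. cinner f b *\<^sub>C b) \<le> norm f"
proof -
  let ?s = "\<Sum>b\<in>F. cinner f b *\<^sub>C b"
  have "cinner (f - ?s) ?s = 0"
    unfolding cinner_sum_right[of "f - ?s"] cinner_scaleC_right
    using cinner_orthonormal_sum[OF assms] by (intro sum.neutral) (auto simp: cinner_diff_left)
  then have "inner (f - ?s) ?s = 0" using Re_cinner[of "f - ?s" ?s] by simp
  then have "(norm f)\<^sup>2 = (norm (f - ?s))\<^sup>2 + (norm ?s)\<^sup>2"
    by (simp add: power2_norm_eq_inner inner_diff inner_commute algebra_simps)
  then show ?thesis by (simp add: power2_le_imp_le)
qed

text \<open>An epsilon/3 argument: \<open>f\<close> is approximated by some \<open>g\<close> with a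
  convergent expansion, and by \<open>bessel\<close> the partial expansions of \<open>f\<close> and
  \<open>g\<close> differ by at most \<open>norm (f - g)\<close>, whatever the finite set.\<close>

lemma closed_orthonormal_expansions:
  fixes B :: "'a::complex_inner set"
  assumes B: "orthonormal B"
  shows "closed {f. ((\<lambda>b. cinner f b *\<^sub>C b) has_sum f) B}" (is "closed ?N")
proof -
  have "f \<in> ?N" if f: "f \<in> closure ?N" for f
  proof -
    have "eventually (\<lambda>F. dist (\<Sum>b\<in>F. cinner f b *\<^sub>C b) f < e) (finite_subsets_at_top B)"
      if e: "e > 0" for e
    proof -
      obtain g where g: "g \<in> ?N" "dist g f < e / 3"
        using f e closure_approachable[of f ?N] by (meson divide_pos_pos zero_less_numeral)
      have "eventually (\<lambda>F. dist (\<Sum>b\<in>F. cinner g b *\<^sub>C b) g < e / 3) (finite_subsets_at_top B)"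
        using g(1) e unfolding has_sum_def mem_Collect_eq by (intro tendstoD) auto
      moreover have "eventually (\<lambda>F. finite F \<and> F \<subseteq> B) (finite_subsets_at_top B)"
        by (rule eventually_finite_subsets_at_top_weakI) simp
      ultimately show ?thesis
      proof eventually_elim
        case (elim F)
        let ?S = "\<lambda>f. \<Sum>b\<in>F. cinner f b *\<^sub>C b"
        have "?S f - ?S g = ?S (f - g)"
          by (simp add: cinner_diff_left scaleC_diff_left sum_subtractf)
        then have "dist (?S f) (?S g) \<le> norm (f - g)"
          using bessel[OF B, of F "f - g"] elim(2) by (simp add: dist_norm)
        moreover have "norm (f - g) < e / 3"
          using g(2) by (simp add: dist_norm norm_minus_commute)
        moreover have "dist (?S f) f \<le> dist (?S f) (?S g) + dist (?S g) g + dist g f"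
          by (smt (verit, best) dist_triangle)
        ultimately show ?case using elim(1) g(2) by linarith
      qed
    qed
    then show ?thesis unfolding has_sum_def by (simp add: tendsto_iff)
  qed
  then show ?thesis unfolding closure_subset_eq[symmetric] by blast
qed

text \<open>The vectors equal to their expansion form a closed subspace \<open>N\<close> containing
  \<open>B\<close>. The residual of \<open>f\<close> after projection onto
  \<open>H \<inter> N\<close> is orthogonal to \<open>B\<close>, hence zero by maximality, and so
  \<open>f\<close> lies in \<open>N\<close>. Maximality is relative to \<open>H\<close>, as in
  \<open>orthonormal_basis\<close>, where only vectors of \<open>l2 W\<close> are tested.\<close>

lemma orthonormal_expansion:
  fixes H :: "'a::complex_inner set"
  assumes H: "csubspace H" "complete H" and B: "orthonormal B" "B \<subseteq> H"
    and max: "\<And>f. f \<in> H \<Longrightarrow> (\<And>b. b \<in> B \<Longrightarrow> cinner f b = 0) \<Longrightarrow> f = 0"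
    and f: "f \<in> H"
  shows "((\<lambda>b. cinner f b *\<^sub>C b) has_sum f) B"
proof -
  define N where "N = {f. ((\<lambda>b. cinner f b *\<^sub>C b) has_sum f) B}"
  have N: "csubspace N"
    unfolding csubspace_def
  proof (intro conjI ballI allI)
    show "x + y \<in> N" if "x \<in> N" "y \<in> N" for x y
      using that unfolding N_def by (auto simp: cinner_add_left scaleC_add_left intro: has_sum_add)
    show "c *\<^sub>C x \<in> N" if "x \<in> N" for c x
      using that has_sum_bounded_linear[OF bounded_linear_scaleC, of "\<lambda>b. cinner x b *\<^sub>C b"]
      by (simp add: N_def cinner_scaleC_left scaleC_scaleC o_def)
  qed (simp add: N_def)
  have BN: "b \<in> N" if b: "b \<in> B" for b
  proof -
    have "((\<lambda>a. cinner b a *\<^sub>C a) has_sum b) {b}"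
      using b B(1) by (intro has_sum_finiteI) (auto simp: orthonormal_def)
    then have "((\<lambda>a. cinner b a *\<^sub>C a) has_sum b) B"
      using b B(1) by (subst has_sum_cong_neutral[where S = "{b}" and T = B and g = "\<lambda>a. cinner b a *\<^sub>C a", symmetric])
        (auto simp: orthonormal_def)
    then show ?thesis by (simp add: N_def)
  qed
  have "closed N" unfolding N_def by (rule closed_orthonormal_expansions[OF B(1)])
  then have "complete (H \<inter> N)" by (rule complete_Int_closed[OF H(2)])
  moreover have "csubspace (H \<inter> N)" using H(1) N by (auto simp: csubspace_def)
  ultimately obtain g where g: "g \<in> H \<inter> N" "\<And>h. h \<in> H \<inter> N \<Longrightarrow> cinner (f - g) h = 0"
    using ex_orthogonal_projection by blast
  have "f - g = 0"
    using g BN B(2) f by (intro max csubspaceD[OF H(1)]) auto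
  then show ?thesis using g(1) by (simp add: N_def)
qed

lemma parseval:
  fixes H :: "'a::complex_inner set"
  assumes "csubspace H" "complete H" "orthonormal B" "B \<subseteq> H"
    and "\<And>f. f \<in> H \<Longrightarrow> (\<And>b. b \<in> B \<Longrightarrow> cinner f b = 0) \<Longrightarrow> f = 0"
    and "f \<in> H"
  shows "((\<lambda>b. cinner f b * cinner b g) has_sum cinner f g) B"
proof -
  have "bounded_linear (\<lambda>x. cinner x g)"
  proof (rule bounded_linear_intro[of _ "norm g"])
    show "cinner (r *\<^sub>R x) g = r *\<^sub>R cinner x g" for r x
      by (simp add: scaleC_of_real[symmetric] cinner_scaleC_left scaleR_conv_of_real scaleC_complex_def)
  qed (simp_all add: cinner_add_left norm_cinner_le)
  from has_sum_bounded_linear[OF this orthonormal_expansion[OF assms]]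
  show ?thesis by (simp add: cinner_scaleC_left o_def)
qed

text \<open>Gram-Schmidt, with the invariant that every spanning vector treated so far is reproduced
  by its own expansion. A new vector contributes its normalized residual, or nothing if the residual
  vanishes; linearity then extends the expansion from the spanning vectors to all
  \<open>x\<close>.\<close>

lemma ex_finite_orthonormal_basis:
  assumes "finite_dim_complex TYPE('e::complex_inner)"
  obtains X :: "'e::complex_inner set" where "finite X" "orthonormal X" "\<And>x. x = (\<Sum>e\<in>X. cinner x e *\<^sub>C e)"
proof -
  obtain B :: "'e set" where B: "finite B" "\<And>x. \<exists>c. x = (\<Sum>b\<in>B. c b *\<^sub>C b)"
    using assms unfolding finite_dim_complex_def by blast
  have "\<exists>X. finite X \<and> orthonormal X \<and> (\<forall>b\<in>B. b = (\<Sum>e\<in>X. cinner b e *\<^sub>C e))"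
    using B(1)
  proof induction
    case empty
    show ?case by (intro exI[of _ "{}"]) (simp add: orthonormal_def)
  next
    case (insert b B)
    then obtain X where X: "finite X" "orthonormal X" "\<And>a. a \<in> B \<Longrightarrow> a = (\<Sum>e\<in>X. cinner a e *\<^sub>C e)"
      by blast
    define r where "r = b - (\<Sum>e\<in>X. cinner b e *\<^sub>C e)"
    have r: "cinner r e = 0" if "e \<in> X" for e
      using cinner_orthonormal_sum[OF X(2,1), of e "cinner b"] that by (simp add: r_def cinner_diff_left)
    have r': "cinner e r = 0" if "e \<in> X" for e
      using r[OF that] cinner_commute[of e r] by simp
    show ?case
    proof (cases "r = 0")
      case True
      with X show ?thesis by (intro exI[of _ X]) (auto simp: r_def)
    next
      case False
      define u where "u = complex_of_real (inverse (norm r)) *\<^sub>C r"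
      have uu: "cinner u u = 1"
        using False by (simp add: cinner_self u_def norm_scaleC norm_inverse)
      have ux: "cinner u e = 0" "cinner e u = 0" if "e \<in> X" for e
        using r r' that by (simp_all add: u_def cinner_scaleC_left cinner_scaleC_right)
      have uX: "u \<notin> X" using uu ux by force
      have ON: "orthonormal (insert u X)"
        using X(2) uu ux uX by (auto simp: orthonormal_def)
      have "cinner a u = 0" if "a \<in> B" for a
        using ux(2) by (subst X(3)[OF that]) (simp add: cinner_sum_left cinner_scaleC_left)
      then have "a = (\<Sum>e\<in>insert u X. cinner a e *\<^sub>C e)" if "a \<in> B" for a
        using X(1) X(3)[OF that] uX that by simp
      moreover have "b = (\<Sum>e\<in>insert u X. cinner b e *\<^sub>C e)"
      proof -
        have ru: "r = complex_of_real (norm r) *\<^sub>C u"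
          using False by (simp add: u_def scaleC_scaleC)
        have beq: "b = r + (\<Sum>e\<in>X. cinner b e *\<^sub>C e)" by (simp add: r_def)
        have "cinner b u = cinner r u"
          using ux(2) by (subst beq) (simp add: cinner_add_left cinner_sum_left cinner_scaleC_left)
        also have "\<dots> = norm r" using uu by (subst ru) (simp add: cinner_scaleC_left)
        finally have "cinner b u *\<^sub>C u = r" using ru by simp
        then show ?thesis using X(1) uX beq by simp
      qed
      ultimately show ?thesis using X(1) ON by (intro exI[of _ "insert u X"]) auto
    qed
  qed
  then obtain X where X: "finite X" "orthonormal X" "\<And>b. b \<in> B \<Longrightarrow> b = (\<Sum>e\<in>X. cinner b e *\<^sub>C e)"
    by blast
  have "x = (\<Sum>e\<in>X. cinner x e *\<^sub>C e)" for x
  proof -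
    obtain c where c: "x = (\<Sum>b\<in>B. c b *\<^sub>C b)" using B(2) by blast
    have "(\<Sum>e\<in>X. cinner x e *\<^sub>C e) = (\<Sum>e\<in>X. \<Sum>b\<in>B. c b *\<^sub>C cinner b e *\<^sub>C e)"
      by (simp add: c cinner_sum_left cinner_scaleC_left scaleC_sum_left scaleC_scaleC)
    also have "\<dots> = (\<Sum>b\<in>B. c b *\<^sub>C (\<Sum>e\<in>X. cinner b e *\<^sub>C e))"
      by (subst sum.swap) (simp add: scaleC_sum_right)
    also have "\<dots> = x" using X(3) by (simp add: c)
    finally show ?thesis by simp
  qed
  with X that show ?thesis by blast
qed

text \<open>Convergence is coordinatewise in a finite orthonormal basis, and each coordinate of a
  Cauchy sequence is Cauchy in the complex numbers.\<close>

lemma complete_UNIV_finite_dim_complex: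
  assumes "finite_dim_complex TYPE('e::complex_inner)"
  shows "complete (UNIV :: 'e::complex_inner set)"
  unfolding complete_def
proof (intro allI impI)
  fix u :: "nat \<Rightarrow> 'e" assume u: "(\<forall>n. u n \<in> UNIV) \<and> Cauchy u"
  obtain X :: "'e set" where X: "finite X" "orthonormal X" "\<And>x. x = (\<Sum>e\<in>X. cinner x e *\<^sub>C e)"
    using ex_finite_orthonormal_basis[OF assms] by blast
  have "\<exists>c. (\<lambda>n. cinner (u n) e) \<longlonglongrightarrow> c" if e: "e \<in> X" for e
  proof -
    have "Cauchy (\<lambda>n. cinner (u n) e)"
    proof (rule CauchyI)
      fix r :: real assume "r > 0"
      then obtain N where N: "\<And>m n. m \<ge> N \<Longrightarrow> n \<ge> N \<Longrightarrow> norm (u m - u n) < r"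
        using u CauchyD by metis
      have "norm (cinner (u m) e - cinner (u n) e) < r" if "m \<ge> N" "n \<ge> N" for m n
        using norm_cinner_le[of "u m - u n" e] orthonormal_norm[OF X(2) e] N[OF that]
        by (simp add: cinner_diff_left)
      then show "\<exists>N. \<forall>m\<ge>N. \<forall>n\<ge>N. norm (cinner (u m) e - cinner (u n) e) < r" by blast
    qed
    then show ?thesis by (simp add: Cauchy_convergent_iff convergent_def)
  qed
  then obtain c where c: "\<And>e. e \<in> X \<Longrightarrow> (\<lambda>n. cinner (u n) e) \<longlonglongrightarrow> c e" by metis
  have "(\<lambda>n. cinner (u n) e *\<^sub>C e) \<longlonglongrightarrow> c e *\<^sub>C e" if "e \<in> X" for e
  proof (rule Lim_null_comparison[THEN LIM_zero_cancel])
    show "\<forall>\<^sub>F n in sequentially. norm (cinner (u n) e *\<^sub>C e - c e *\<^sub>C e) \<le> cmod (cinner (u n) e - c e) * norm e"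
      by (simp add: scaleC_diff_left[symmetric] norm_scaleC)
    show "(\<lambda>n. cmod (cinner (u n) e - c e) * norm e) \<longlonglongrightarrow> 0"
      using c[OF that] by (auto intro!: tendsto_eq_intros simp: LIM_zero_iff)
  qed
  then have "(\<lambda>n. \<Sum>e\<in>X. cinner (u n) e *\<^sub>C e) \<longlonglongrightarrow> (\<Sum>e\<in>X. c e *\<^sub>C e)"
    by (intro tendsto_sum) auto
  then show "\<exists>l\<in>UNIV. u \<longlonglongrightarrow> l" using X(3) by auto
qed

section \<open>The space of square-summable families as a complex inner product space\<close>

lemma l2_add:
  assumes "f \<in> l2 W" "g \<in> l2 W"
  shows "(\<lambda>w. f w + g w) \<in> l2 W"
proof -
  have "(\<lambda>w. 2 * (norm (f w))\<^sup>2 + 2 * (norm (g w))\<^sup>2) summable_on W"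
    using assms by (intro summable_on_add summable_on_cmult_right) (auto simp: l2_def)
  moreover have "(norm (f w + g w))\<^sup>2 \<le> 2 * (norm (f w))\<^sup>2 + 2 * (norm (g w))\<^sup>2" for w
    using parallelogram[of "f w" "g w"] by (metis add_increasing2 order_refl zero_le_power2)
  ultimately have "(\<lambda>w. (norm (f w + g w))\<^sup>2) summable_on W"
    by (rule summable_on_comparison_test) auto
  with assms show ?thesis by (auto simp: l2_def)
qed

lemma l2_scaleC:
  assumes "f \<in> l2 W"
  shows "(\<lambda>w. c *\<^sub>C f w) \<in> l2 W"
  using assms by (auto simp: l2_def norm_scaleC power_mult_distrib intro!: summable_on_cmult_right)

lemma l2_scaleR:
  assumes "f \<in> l2 W"
  shows "(\<lambda>w. r *\<^sub>R f w) \<in> l2 W"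
  using l2_scaleC[OF assms, of "of_real r"] by (simp add: scaleC_of_real)

lemma l2_zero: "(\<lambda>w. 0) \<in> l2 W"
  by (simp add: l2_def)

lemma l2_diff:
  assumes "f \<in> l2 W" "g \<in> l2 W"
  shows "(\<lambda>w. f w - g w) \<in> l2 W"
  using l2_add[OF assms(1) l2_scaleR[OF assms(2), of "-1"]] by simp

lemma l2_cinner_summable:
  assumes "f \<in> l2 W" "g \<in> l2 W"
  shows "(\<lambda>w. cinner (f w) (g w)) summable_on W"
proof -
  have "(\<lambda>w. (norm (f w))\<^sup>2 + (norm (g w))\<^sup>2) summable_on W"
    using assms by (intro summable_on_add) (auto simp: l2_def)
  moreover have "norm (cinner (f w) (g w)) \<le> (norm (f w))\<^sup>2 + (norm (g w))\<^sup>2" for w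
  proof -
    have "0 \<le> norm (f w) * norm (g w)" by simp
    then show ?thesis
      using norm_cinner_le[of "f w" "g w"] sum_squares_bound[of "norm (f w)" "norm (g w)"] by linarith
  qed
  ultimately have "(\<lambda>w. norm (cinner (f w) (g w))) summable_on W"
    by (rule summable_on_comparison_test) auto
  then show ?thesis by (rule abs_summable_summable)
qed

lemma l2_subset_UNIV: "f \<in> l2 W \<Longrightarrow> f \<in> l2 UNIV"
proof -
  assume f: "f \<in> l2 W"
  have "(\<lambda>w. (norm (f w))\<^sup>2) summable_on W \<longleftrightarrow> (\<lambda>w. (norm (f w))\<^sup>2) summable_on UNIV"
    using f by (intro summable_on_cong_neutral) (auto simp: l2_def)
  with f show "f \<in> l2 UNIV" by (auto simp: l2_def)
qed

lemma l2_inner_UNIV: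
  assumes "f \<in> l2 W" 
  shows "l2_inner W f g = l2_inner UNIV f g"
  unfolding l2_inner_def using assms by (intro infsum_cong_neutral) (auto simp: l2_def)

text \<open>Type class instances need a type, and a type cannot depend on the set \<open>W\<close>.
  One type over \<open>UNIV\<close> serves all index sets: \<open>l2 W\<close> becomes its subspace
  of families vanishing outside \<open>W\<close>, with the same inner product.\<close>

typedef (overloaded) ('w, 'e) ell2 = "l2 UNIV :: ('w \<Rightarrow> 'e::complex_inner) set"
  using l2_zero by blast

setup_lifting type_definition_ell2

instantiation ell2 :: (type, complex_inner) complex_inner
begin

lift_definition zero_ell2 :: "('a, 'b) ell2" is "\<lambda>w. 0" by (rule l2_zero)
lift_definition plus_ell2 :: "('a, 'b) ell2 \<Rightarrow> ('a, 'b) ell2 \<Rightarrow> ('a, 'b) ell2"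
  is "\<lambda>f g w. f w + g w" by (rule l2_add)
lift_definition minus_ell2 :: "('a, 'b) ell2 \<Rightarrow> ('a, 'b) ell2 \<Rightarrow> ('a, 'b) ell2"
  is "\<lambda>f g w. f w - g w" by (rule l2_diff)
lift_definition scaleR_ell2 :: "real \<Rightarrow> ('a, 'b) ell2 \<Rightarrow> ('a, 'b) ell2"
  is "\<lambda>r f w. r *\<^sub>R f w" by (rule l2_scaleR)
lift_definition scaleC_ell2 :: "complex \<Rightarrow> ('a, 'b) ell2 \<Rightarrow> ('a, 'b) ell2"
  is "\<lambda>c f w. c *\<^sub>C f w" by (rule l2_scaleC)
lift_definition cinner_ell2 :: "('a, 'b) ell2 \<Rightarrow> ('a, 'b) ell2 \<Rightarrow> complex"
  is "l2_inner UNIV" .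

definition uminus_ell2 :: "('a, 'b) ell2 \<Rightarrow> ('a, 'b) ell2"
  where "uminus_ell2 F = 0 - F"
definition inner_ell2 :: "('a, 'b) ell2 \<Rightarrow> ('a, 'b) ell2 \<Rightarrow> real"
  where "inner_ell2 F G = Re (cinner F G)"
definition norm_ell2 :: "('a, 'b) ell2 \<Rightarrow> real"
  where "norm_ell2 F = sqrt (inner F F)"
definition sgn_ell2 :: "('a, 'b) ell2 \<Rightarrow> ('a, 'b) ell2"
  where "sgn_ell2 F = inverse (norm F) *\<^sub>R F"
definition dist_ell2 :: "('a, 'b) ell2 \<Rightarrow> ('a, 'b) ell2 \<Rightarrow> real"
  where "dist_ell2 F G = norm (F - G)"
definition uniformity_ell2 :: "(('a, 'b) ell2 \<times> ('a, 'b) ell2) filter"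
  where "uniformity_ell2 = (INF e\<in>{0 <..}. principal {(F, G). dist F G < e})"
definition open_ell2 :: "('a, 'b) ell2 set \<Rightarrow> bool"
  where "open_ell2 U \<longleftrightarrow> (\<forall>x\<in>U. eventually (\<lambda>(x', y). x' = x \<longrightarrow> y \<in> U) uniformity)"

instance
proof
  fix F G K :: "('a, 'b) ell2" and r s :: real and c d :: complex
  have add: "cinner (F + G) K = cinner F K + cinner G K" for F G K :: "('a, 'b) ell2"
    by transfer (simp add: l2_inner_def cinner_add_left infsum_add l2_cinner_summable)
  have scale: "cinner (c *\<^sub>C F) G = c * cinner F G" for c and F G :: "('a, 'b) ell2"
    by transfer (simp add: l2_inner_def cinner_scaleC_left infsum_cmult_right')
  have comm: "cinner F G = cnj (cinner G F)" for F G :: "('a, 'b) ell2"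
    by transfer (simp add: l2_inner_def infsum_cnj[symmetric] cinner_commute[symmetric] del: infsum_cnj)
  have scaleC_real: "complex_of_real r *\<^sub>C F = r *\<^sub>R F" for r and F :: "('a, 'b) ell2"
    by transfer (simp add: scaleC_of_real)
  \<comment> \<open>Rewriting the complex series as a real one with nonnegative terms gives
    positivity and definiteness at once.\<close>
  have sq: "inner F F = infsum (\<lambda>w. (norm (Rep_ell2 F w))\<^sup>2) UNIV" for F :: "('a, 'b) ell2"
  proof -
    have "cinner F F = infsum (\<lambda>w. of_real ((norm (Rep_ell2 F w))\<^sup>2)) UNIV"
      by (simp only: cinner_ell2.rep_eq l2_inner_def cinner_self)
    moreover have "((\<lambda>w. complex_of_real ((norm (Rep_ell2 F w))\<^sup>2))
        has_sum of_real (infsum (\<lambda>w. (norm (Rep_ell2 F w))\<^sup>2) UNIV)) UNIV"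
      using Rep_ell2[of F] by (intro has_sum_of_real) (simp add: l2_def)
    ultimately show ?thesis by (simp add: inner_ell2_def infsumI)
  qed
  show "F + G + K = F + (G + K)" "F + G = G + F" "0 + F = F" 
    by (transfer; simp add: add_ac)+
  show "- F + F = 0" "F - G = F + - G"
    unfolding uminus_ell2_def by (transfer; simp)+
  show "r *\<^sub>R (F + G) = r *\<^sub>R F + r *\<^sub>R G" "(r + s) *\<^sub>R F = r *\<^sub>R F + s *\<^sub>R F"
    "r *\<^sub>R s *\<^sub>R F = (r * s) *\<^sub>R F" "1 *\<^sub>R F = F"
    by (transfer; simp add: algebra_simps)+
  show "c *\<^sub>C (F + G) = c *\<^sub>C F + c *\<^sub>C G" "(c + d) *\<^sub>C F = c *\<^sub>C F + d *\<^sub>C F"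
    "c *\<^sub>C d *\<^sub>C F = (c * d) *\<^sub>C F"
    by (transfer; simp add: scaleC_add_left scaleC_add_right scaleC_scaleC)+
  show "complex_of_real r *\<^sub>C F = r *\<^sub>R F" by (rule scaleC_real)
  show "sgn F = inverse (norm F) *\<^sub>R F" by (rule sgn_ell2_def)
  show "dist F G = norm (F - G)" by (rule dist_ell2_def)
  show "(uniformity :: (('a, 'b) ell2 \<times> ('a, 'b) ell2) filter) = (INF e\<in>{0 <..}. principal {(F, G). dist F G < e})"
    by (rule uniformity_ell2_def)
  show "open U \<longleftrightarrow> (\<forall>x\<in>U. \<forall>\<^sub>F (x', y) in uniformity. x' = x \<longrightarrow> y \<in> U)" for U :: "('a, 'b) ell2 set"
    by (rule open_ell2_def)
  show "inner F G = inner G F" unfolding inner_ell2_def by (subst comm) simp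
  show "inner (F + G) K = inner F K + inner G K" by (simp add: inner_ell2_def add)
  show "inner (r *\<^sub>R F) G = r * inner F G"
    by (simp add: inner_ell2_def scaleC_real[symmetric] scale)
  show "0 \<le> inner F F" unfolding sq by (rule infsum_nonneg) simp
  show "inner F F = 0 \<longleftrightarrow> F = 0"
  proof
    assume "inner F F = 0"
    then have "(norm (Rep_ell2 F w))\<^sup>2 = 0" for w
      unfolding sq using Rep_ell2[of F]
      by (intro nonneg_infsum_le_0D[where A = UNIV]) (auto simp: l2_def)
    then show "F = 0" by transfer auto
  next
    assume "F = 0"
    then show "inner F F = 0" unfolding sq by (simp add: zero_ell2.rep_eq)
  qed
  show "norm F = sqrt (inner F F)" by (rule norm_ell2_def)
  show "cinner (F + G) K = cinner F K + cinner G K" by (rule add)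
  show "cinner (c *\<^sub>C F) G = c * cinner F G" by (rule scale)
  show "cinner F G = cnj (cinner G F)" by (rule comm)
  show "Re (cinner F G) = inner F G" by (simp add: inner_ell2_def)
qed

end

lemma norm_sq_ell2: "((\<lambda>w. (norm (Rep_ell2 F w))\<^sup>2) has_sum (norm F)\<^sup>2) UNIV"
proof -
  have s: "(\<lambda>w. (norm (Rep_ell2 F w))\<^sup>2) summable_on UNIV"
    using Rep_ell2[of F] by (simp add: l2_def)
  have "of_real ((norm F)\<^sup>2) = infsum (\<lambda>w. complex_of_real ((norm (Rep_ell2 F w))\<^sup>2)) UNIV"
    unfolding cinner_self[symmetric] by (simp only: cinner_ell2.rep_eq l2_inner_def)
  also have "\<dots> = of_real (infsum (\<lambda>w. (norm (Rep_ell2 F w))\<^sup>2) UNIV)"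
    using s by (intro infsumI has_sum_of_real) simp
  finally show ?thesis using s by (simp only: of_real_eq_iff) simp
qed

lemma sum_norm_sq_le_ell2: "finite A \<Longrightarrow> (\<Sum>w\<in>A. (norm (Rep_ell2 F w))\<^sup>2) \<le> (norm F)\<^sup>2"
  using norm_sq_ell2 by (rule finite_sum_le_has_sum) auto

lemma norm_Rep_ell2_le: "norm (Rep_ell2 F w) \<le> norm F"
  using sum_norm_sq_le_ell2[of "{w}" F] by (intro power2_le_imp_le[of "norm (Rep_ell2 F w)"]) simp_all

lemma complete_UNIV_ell2:
  assumes "complete (UNIV :: 'e::complex_inner set)"
  shows "complete (UNIV :: ('w, 'e) ell2 set)"
  unfolding complete_def
proof (intro allI impI)
  fix U :: "nat \<Rightarrow> ('w, 'e) ell2" assume "(\<forall>n. U n \<in> UNIV) \<and> Cauchy U"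
  then have U: "\<And>e. e > 0 \<Longrightarrow> \<exists>N. \<forall>m\<ge>N. \<forall>n\<ge>N. norm (U m - U n) < e"
    by (auto simp: Cauchy_iff)
  have "\<exists>l. (\<lambda>n. Rep_ell2 (U n) w) \<longlonglongrightarrow> l" for w
  proof -
    have "Cauchy (\<lambda>n. Rep_ell2 (U n) w)"
    proof (rule CauchyI)
      fix e :: real assume "e > 0"
      with U obtain N where "\<And>m n. m \<ge> N \<Longrightarrow> n \<ge> N \<Longrightarrow> norm (U m - U n) < e" by blast
      moreover have "norm (Rep_ell2 (U m) w - Rep_ell2 (U n) w) \<le> norm (U m - U n)" for m n
        using norm_Rep_ell2_le[of "U m - U n" w] by (simp add: minus_ell2.rep_eq)
      ultimately show "\<exists>N. \<forall>m\<ge>N. \<forall>n\<ge>N. norm (Rep_ell2 (U m) w - Rep_ell2 (U n) w) < e"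
        by (meson order_le_less_trans)
    qed
    with assms show ?thesis unfolding complete_def by blast
  qed
  then obtain f where f: "\<And>w. (\<lambda>n. Rep_ell2 (U n) w) \<longlonglongrightarrow> f w" by metis
  \<comment> \<open>Letting n tend to infinity for a fixed finite \<open>A\<close> gives a bound
    that does not depend on \<open>A\<close>. It serves twice: it puts the difference to the
    pointwise limit \<open>f\<close> into the space, and it bounds the norm of that
    difference.\<close>
  have fin: "(\<Sum>w\<in>A. (norm (Rep_ell2 (U m) w - f w))\<^sup>2) \<le> e\<^sup>2"
    if "finite A" "\<And>n. n \<ge> N \<Longrightarrow> norm (U m - U n) < e" for A m e N
  proof (rule LIMSEQ_le_const2)
    show "(\<lambda>n. \<Sum>w\<in>A. (norm (Rep_ell2 (U m) w - Rep_ell2 (U n) w))\<^sup>2)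
        \<longlonglongrightarrow> (\<Sum>w\<in>A. (norm (Rep_ell2 (U m) w - f w))\<^sup>2)"
      by (intro tendsto_intros f)
    have "(\<Sum>w\<in>A. (norm (Rep_ell2 (U m) w - Rep_ell2 (U n) w))\<^sup>2) \<le> e\<^sup>2" if "n \<ge> N" for n
    proof -
      have "(\<Sum>w\<in>A. (norm (Rep_ell2 (U m) w - Rep_ell2 (U n) w))\<^sup>2) \<le> (norm (U m - U n))\<^sup>2"
        using sum_norm_sq_le_ell2[OF \<open>finite A\<close>, of "U m - U n"] by (simp add: minus_ell2.rep_eq)
      also have "\<dots> \<le> e\<^sup>2" using \<open>n \<ge> N \<Longrightarrow> norm (U m - U n) < e\<close> that by (intro power_mono) auto
      finally show ?thesis .
    qed
    then show "\<exists>N. \<forall>n\<ge>N. (\<Sum>w\<in>A. (norm (Rep_ell2 (U m) w - Rep_ell2 (U n) w))\<^sup>2) \<le> e\<^sup>2" by blast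
  qed
  have diff: "(\<lambda>w. Rep_ell2 (U m) w - f w) \<in> l2 UNIV" 
    if "\<And>n. n \<ge> N \<Longrightarrow> norm (U m - U n) < e" for m N e
    unfolding l2_def
    by (auto intro!: nonneg_bdd_above_summable_on bdd_aboveI2[of _ _ "e\<^sup>2"] fin[OF _ that])
  obtain N1 where N1: "\<And>n. n \<ge> N1 \<Longrightarrow> norm (U N1 - U n) < 1" using U[of 1] by auto
  have "f \<in> l2 UNIV"
    using l2_diff[OF Rep_ell2[of "U N1"] diff[OF N1]] by simp
  then obtain F where F: "f = Rep_ell2 F" by (metis Rep_ell2_cases)
  have "U \<longlonglongrightarrow> F"
  proof (rule LIMSEQ_I)
    fix r :: real assume r: "r > 0"
    \<comment> \<open>The limit in n weakens the strict inequality, so \<open>r / 2\<close> leaves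
      room for a strict bound by \<open>r\<close>.\<close>
    then obtain N where N: "\<And>m n. m \<ge> N \<Longrightarrow> n \<ge> N \<Longrightarrow> norm (U m - U n) < r / 2"
      using U[of "r / 2"] by auto
    have "norm (U m - F) < r" if m: "m \<ge> N" for m
    proof -
      have "(norm (U m - F))\<^sup>2 \<le> (r / 2)\<^sup>2"
      proof (rule has_sum_le_finite_sums[OF norm_sq_ell2])
        fix A :: "'w set" assume "finite A"
        from fin[OF this N[OF m]] show "(\<Sum>w\<in>A. (norm (Rep_ell2 (U m - F) w))\<^sup>2) \<le> (r / 2)\<^sup>2"
          by (simp add: F minus_ell2.rep_eq)
      qed
      then have "norm (U m - F) \<le> r / 2" by (rule power2_le_imp_le) (use r in simp)
      then show ?thesis using r by simp
    qed
    then show "\<exists>N. \<forall>n\<ge>N. norm (U n - F) < r" by blast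
  qed
  then show "\<exists>l\<in>UNIV. U \<longlonglongrightarrow> l" by blast
qed

section \<open>Orthogonal projections\<close>

text \<open>The defining condition mirrors that of \<open>orth_proj\<close>, so that the two agree
  once vectors are identified through \<open>Rep_ell2\<close>.\<close>

definition cproj :: "'a::complex_inner set \<Rightarrow> 'a \<Rightarrow> 'a"
  where "cproj M x = (THE g. g \<in> M \<and> (\<forall>h\<in>M. cinner (x - g) h = 0))"

lemma cproj_eqI:
  assumes "csubspace M" "g \<in> M" "\<And>h. h \<in> M \<Longrightarrow> cinner (x - g) h = 0"
  shows "cproj M x = g"
  unfolding cproj_def
proof (rule the_equality)
  fix g' assume g': "g' \<in> M \<and> (\<forall>h\<in>M. cinner (x - g') h = 0)"
  have "cinner (g' - g) h = 0" if "h \<in> M" for h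
    using assms(3)[OF that] g' that by (simp add: cinner_diff_left)
  then have "cinner (g' - g) (g' - g) = 0" using assms g' csubspace_diff by blast
  then show "g' = g" by (simp add: cinner_self)
qed (use assms in blast)

context
  fixes M :: "'a::complex_inner set"
  assumes M: "csubspace M" "complete M"
begin

lemma cproj_in: "cproj M x \<in> M"
  and cproj_orth: "h \<in> M \<Longrightarrow> cinner (x - cproj M x) h = 0"
proof -
  obtain g where g: "g \<in> M" "\<And>h. h \<in> M \<Longrightarrow> cinner (x - g) h = 0"
    using ex_orthogonal_projection[OF M] by blast
  with cproj_eqI[OF M(1) this] 
  show "cproj M x \<in> M" "h \<in> M \<Longrightarrow> cinner (x - cproj M x) h = 0" by auto
qed

lemma cinner_cproj: "h \<in> M \<Longrightarrow> cinner (cproj M x) h = cinner x h"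
  using cproj_orth[of h x] by (simp add: cinner_diff_left)

text \<open>The residual is orthogonal to the projection. This equation links the two halves of the
  argument: the left side is a matrix coefficient, which weak convergence controls, and the right
  side a squared norm, which isometries leaving \<open>M\<close> invariant control.\<close>

lemma cinner_cproj_self: "cinner (cproj M x) x = of_real ((norm (cproj M x))\<^sup>2)"
  by (subst cinner_commute, subst cinner_cproj[OF cproj_in, of x, symmetric]) (simp add: cinner_self)

lemma norm_cproj_le: "norm (cproj M x) \<le> norm x"
proof (cases "cproj M x = 0")
  case False
  have "(norm (cproj M x))\<^sup>2 \<le> norm (cproj M x) * norm x"
    using norm_cinner_le[of "cproj M x" x] unfolding cinner_cproj_self by (simp only: norm_of_real abs_power2)
  then show ?thesis using False by (simp add: power2_eq_square)
qed simp

lemma cproj_linear_combination: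
  "cproj M (\<Sum>a\<in>A. c a *\<^sub>C e a) = (\<Sum>a\<in>A. c a *\<^sub>C cproj M (e a))"
proof (rule cproj_eqI[OF M(1)])
  show "(\<Sum>a\<in>A. c a *\<^sub>C cproj M (e a)) \<in> M"
    by (intro csubspace_sum[OF M(1)] csubspace_scaleC[OF M(1)] cproj_in)
  show "cinner ((\<Sum>a\<in>A. c a *\<^sub>C e a) - (\<Sum>a\<in>A. c a *\<^sub>C cproj M (e a))) h = 0" if "h \<in> M" for h
    using cinner_cproj[OF that] by (simp add: cinner_diff_left cinner_sum_left cinner_scaleC_left)
qed

text \<open>Applied to \<open>y = S x\<close> and \<open>P = S (cproj M x)\<close>, where \<open>S\<close> is an isometry mapping \<open>M\<close> into itself.\<close>

lemma norm_cproj_mono: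
  assumes "P \<in> M" "cinner y P = cinner x (cproj M x)" "norm P = norm (cproj M x)"
  shows "norm (cproj M x) \<le> norm (cproj M y)"
proof (cases "cproj M x = 0")
  case False
  have "cinner x (cproj M x) = of_real ((norm (cproj M x))\<^sup>2)"
    using cinner_cproj[OF cproj_in, of x x] by (simp add: cinner_self)
  then have "(norm (cproj M x))\<^sup>2 = cmod (cinner (cproj M y) P)"
    using assms(2) cinner_cproj[OF assms(1), of y] by (simp only: norm_of_real abs_power2)
  also have "\<dots> \<le> norm (cproj M y) * norm (cproj M x)"
    using norm_cinner_le[of "cproj M y" P] assms(3) by simp
  finally show ?thesis using False by (simp add: power2_eq_square)
qed simp

text \<open>The operator is the projection onto \<open>M\<close> after the map sending
  \<open>b\<close> to the sum of its components along the vectors \<open>e a\<close>. Parseval in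
  the unknown basis \<open>B\<close> collapses the sum over \<open>b\<close> for each
  \<open>a\<close> separately; the sum over \<open>a\<close> is a finite-type sum outside and needs
  no exchange argument beyond additivity.\<close>

lemma has_sum_trace_cproj:
  assumes H: "csubspace H" "complete H" "M \<subseteq> H" and B: "orthonormal B" "B \<subseteq> H"
    and max: "\<And>f. f \<in> H \<Longrightarrow> (\<And>b. b \<in> B \<Longrightarrow> cinner f b = 0) \<Longrightarrow> f = 0"
  shows "((\<lambda>b. cinner (cproj M (\<Sum>a\<in>A. cinner b (e a) *\<^sub>C e a)) b) has_sum
    of_real (\<Sum>a\<in>A. (norm (cproj M (e a)))\<^sup>2)) B"
proof -
  have "((\<lambda>b. cinner (cproj M (e a)) b * cinner b (e a)) has_sum cinner (cproj M (e a)) (e a)) B" for a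
    using cproj_in H(3) by (intro parseval[OF H(1,2) B max]) auto
  then have "((\<lambda>b. \<Sum>a\<in>A. cinner b (e a) * cinner (cproj M (e a)) b) has_sum
      (\<Sum>a\<in>A. of_real ((norm (cproj M (e a)))\<^sup>2))) B"
    unfolding cinner_cproj_self
    by (induction A rule: infinite_finite_induct) (simp_all add: has_sum_add mult.commute)
  then show ?thesis
    by (simp add: cproj_linear_combination cinner_sum_left cinner_scaleC_left)
qed

end

section \<open>Closed subspaces of square-summable families\<close>

lemma l2E:
  assumes "f \<in> l2 W"
  obtains F where "f = Rep_ell2 F"
  using l2_subset_UNIV[OF assms] by (metis Rep_ell2_cases)

lemma l2_inner_Rep_ell2:
  "Rep_ell2 F \<in> l2 W \<Longrightarrow> l2_inner W (Rep_ell2 F) (Rep_ell2 G) = cinner F G"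
  by (simp add: l2_inner_UNIV cinner_ell2.rep_eq)

lemma l2_norm_Rep_ell2: "Rep_ell2 F \<in> l2 W \<Longrightarrow> l2_norm W (Rep_ell2 F) = norm F"
  by (simp add: l2_norm_def l2_inner_Rep_ell2 cinner_self)

lemma Rep_ell2_sum: "Rep_ell2 (\<Sum>a\<in>A. F a) = (\<lambda>w. \<Sum>a\<in>A. Rep_ell2 (F a) w)"
  by (induction A rule: infinite_finite_induct) (simp_all add: zero_ell2.rep_eq plus_ell2.rep_eq)

lemma closed_subspace_l2: "closed_subspace W (l2 W)"
  by (auto simp: closed_subspace_def intro: l2_zero l2_add l2_scaleC)

context
  fixes W :: "'w set" and M :: "('w \<Rightarrow> 'e::complex_inner) set"
  assumes M: "closed_subspace W M"
begin

lemma csubspace_Rep_ell2: "csubspace {F. Rep_ell2 F \<in> M}"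
  using M by (auto simp: csubspace_def closed_subspace_def zero_ell2.rep_eq plus_ell2.rep_eq scaleC_ell2.rep_eq)

text \<open>\<open>closed_subspace\<close> speaks only of limits inside \<open>l2 W\<close>. A limit
  taken in the larger space must first be shown to vanish outside \<open>W\<close>, which holds
  because evaluation at an index is a contraction.\<close>

lemma closed_Rep_ell2: "closed {F. Rep_ell2 F \<in> M}"
proof -
  let ?M = "{F. Rep_ell2 F \<in> M}"
  have sub: "M \<subseteq> l2 W" using M by (simp add: closed_subspace_def)
  have "F \<in> ?M" if F: "F \<in> closure ?M" for F
  proof -
    have near: "\<exists>G. Rep_ell2 G \<in> M \<and> norm (F - G) < \<epsilon>" if "\<epsilon> > 0" for \<epsilon>
      using F that closure_approachable[of F ?M] by (auto simp: dist_norm norm_minus_commute)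
    have "Rep_ell2 F w = 0" if w: "w \<notin> W" for w
    proof (rule ccontr)
      assume "Rep_ell2 F w \<noteq> 0"
      then obtain G where G: "Rep_ell2 G \<in> M" "norm (F - G) < norm (Rep_ell2 F w)"
        using near[of "norm (Rep_ell2 F w)"] by auto
      have "Rep_ell2 G w = 0" using G(1) sub w by (auto simp: l2_def)
      then show False using G(2) norm_Rep_ell2_le[of "F - G" w] by (simp add: minus_ell2.rep_eq)
    qed
    moreover have "(\<lambda>w. (norm (Rep_ell2 F w))\<^sup>2) summable_on W"
      using norm_sq_ell2[of F] by (rule summable_on_subset[OF has_sum_imp_summable]) simp
    ultimately have F2: "Rep_ell2 F \<in> l2 W" by (simp add: l2_def)
    have "\<exists>g\<in>M. l2_norm W (\<lambda>w. Rep_ell2 F w - g w) < \<epsilon>" if "\<epsilon> > 0" for \<epsilon>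
    proof -
      obtain G where G: "Rep_ell2 G \<in> M" "norm (F - G) < \<epsilon>" using near[OF \<open>\<epsilon> > 0\<close>] by blast
      have "Rep_ell2 (F - G) \<in> l2 W"
        unfolding minus_ell2.rep_eq using G(1) sub F2 by (intro l2_diff) auto
      from l2_norm_Rep_ell2[OF this] G show ?thesis unfolding minus_ell2.rep_eq by metis
    qed
    then show "F \<in> ?M" using M F2 by (auto simp: closed_subspace_def)
  qed
  then show ?thesis unfolding closure_subset_eq[symmetric] by blast
qed

lemma complete_Rep_ell2:
  assumes "complete (UNIV :: 'e set)"
  shows "complete {F. Rep_ell2 F \<in> M}"
  using complete_Int_closed[OF complete_UNIV_ell2[OF assms] closed_Rep_ell2] by simp

text \<open>Every member of \<open>M\<close> is the representation of an \<open>ell2\<close> vector,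
  so the two definite descriptions range over the same candidates and impose the same orthogonality
  conditions.\<close>

lemma orth_proj_Rep_ell2:
  assumes "complete (UNIV :: 'e set)" and F: "Rep_ell2 F \<in> l2 W"
  shows "orth_proj W M (Rep_ell2 F) = Rep_ell2 (cproj {F. Rep_ell2 F \<in> M} F)"
proof -
  let ?M = "{F. Rep_ell2 F \<in> M}"
  have sub: "M \<subseteq> l2 W" using M by (simp add: closed_subspace_def)
  note M' = csubspace_Rep_ell2 complete_Rep_ell2[OF assms(1)]
  have inner_eq: "l2_inner W (\<lambda>w. Rep_ell2 F w - Rep_ell2 G w) (Rep_ell2 K) = cinner (F - G) K"
    if "Rep_ell2 G \<in> M" for G K
    using l2_inner_Rep_ell2[of "F - G" W K] l2_diff[OF F, of "Rep_ell2 G"] that sub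
    by (auto simp: minus_ell2.rep_eq)
  show ?thesis
    unfolding orth_proj_def
  proof (rule the_equality, intro conjI ballI)
    show in_M: "Rep_ell2 (cproj ?M F) \<in> M" using cproj_in[OF M'] by blast
    fix h assume h: "h \<in> M"
    then obtain K where "h = Rep_ell2 K" using sub l2E by blast
    with cproj_orth[OF M', of K F] h inner_eq[OF in_M]
    show "l2_inner W (\<lambda>w. Rep_ell2 F w - Rep_ell2 (cproj ?M F) w) h = 0" by simp
  next
    fix g assume g: "g \<in> M \<and> (\<forall>h\<in>M. l2_inner W (\<lambda>w. Rep_ell2 F w - g w) h = 0)"
    then obtain G where G: "g = Rep_ell2 G" using sub l2E by blast
    have "cproj ?M F = G"
      using g G inner_eq[of G] by (intro cproj_eqI M') auto
    with G show "g = Rep_ell2 (cproj ?M F)" by simp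
  qed
qed

end

text \<open>Existence of some basis suffices to know that the one chosen by \<open>SOME\<close> is a
  basis; its preimage \<open>B'\<close> in \<open>ell2\<close> is orthonormal and maximal, and the
  trace formula for arbitrary such sets applies.\<close>

lemma trace_op_orth_proj:
  fixes M :: "('w \<Rightarrow> 'e::complex_inner) set"
  assumes M: "closed_subspace W M"
    and complete: "complete (UNIV :: 'e set)" and ex_basis: "\<exists>B :: ('w \<Rightarrow> 'e) set. orthonormal_basis W B"
    and e: "\<And>a. a \<in> A \<Longrightarrow> Rep_ell2 (e a) \<in> l2 W"
    and D: "\<And>F. Rep_ell2 F \<in> l2 W \<Longrightarrow> D (Rep_ell2 F) = Rep_ell2 (\<Sum>a\<in>A. cinner F (e a) *\<^sub>C e a)"
  shows "trace_op W (\<lambda>f. orth_proj W M (D f)) =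
    of_real (\<Sum>a\<in>A. (norm (cproj {F. Rep_ell2 F \<in> M} (e a)))\<^sup>2)"
proof -
  let ?M = "{F. Rep_ell2 F \<in> M}" and ?H = "{F :: ('w, 'e) ell2. Rep_ell2 F \<in> l2 W}"
  define B :: "('w \<Rightarrow> 'e) set" where "B = (SOME B. orthonormal_basis W B)"
  have ob: "orthonormal_basis W B" unfolding B_def using ex_basis by (rule someI_ex)
  define B' where "B' = {F. Rep_ell2 F \<in> B}"
  have sub: "M \<subseteq> l2 W" using M by (simp add: closed_subspace_def)
  have BB': "B = Rep_ell2 ` B'"
  proof -
    have "b \<in> Rep_ell2 ` B'" if b: "b \<in> B" for b
    proof -
      have "b \<in> l2 W" using b ob by (auto simp: orthonormal_basis_def)
      then obtain F where "b = Rep_ell2 F" by (rule l2E)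
      with b show ?thesis by (auto simp: B'_def)
    qed
    then show ?thesis by (auto simp: B'_def)
  qed
  have B'H: "B' \<subseteq> ?H" using ob by (auto simp: B'_def orthonormal_basis_def)
  have on: "orthonormal B'"
    unfolding orthonormal_def
  proof (intro ballI)
    fix F G assume "F \<in> B'" "G \<in> B'"
    then show "cinner F G = (if F = G then 1 else 0)"
      using ob B'H l2_inner_Rep_ell2[of F W G]
      by (auto simp: B'_def orthonormal_basis_def Rep_ell2_inject)
  qed
  have max: "F = 0" if F: "F \<in> ?H" and 0: "\<And>b. b \<in> B' \<Longrightarrow> cinner F b = 0" for F
  proof -
    have "l2_inner W (Rep_ell2 F) b = 0" if "b \<in> B" for b
      using that F 0 unfolding BB' by (auto simp: l2_inner_Rep_ell2)
    then have "Rep_ell2 F = (\<lambda>w. 0)" using ob F by (auto simp: orthonormal_basis_def)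
    then show ?thesis by (simp add: Rep_ell2_inject[symmetric] zero_ell2.rep_eq)
  qed
  note H = csubspace_Rep_ell2[OF M] complete_Rep_ell2[OF M complete]
  note HW = csubspace_Rep_ell2[OF closed_subspace_l2] complete_Rep_ell2[OF closed_subspace_l2 complete]
  have "l2_inner W (orth_proj W M (D (Rep_ell2 F))) (Rep_ell2 F) =
      cinner (cproj ?M (\<Sum>a\<in>A. cinner F (e a) *\<^sub>C e a)) F" if "F \<in> B'" for F
  proof -
    let ?s = "\<Sum>a\<in>A. cinner F (e a) *\<^sub>C e a"
    have "?s \<in> ?H" using e by (intro csubspace_sum[OF HW(1)] csubspace_scaleC[OF HW(1)]) auto
    moreover have "Rep_ell2 (cproj ?M ?s) \<in> l2 W" using cproj_in[OF H] sub by blast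
    ultimately show ?thesis
      using that B'H D[of F] by (auto simp: orth_proj_Rep_ell2[OF M complete] l2_inner_Rep_ell2)
  qed
  moreover have "((\<lambda>F. cinner (cproj ?M (\<Sum>a\<in>A. cinner F (e a) *\<^sub>C e a)) F) has_sum
      of_real (\<Sum>a\<in>A. (norm (cproj ?M (e a)))\<^sup>2)) B'"
    using sub by (intro has_sum_trace_cproj[OF H HW _ on B'H max]) auto
  ultimately have "((\<lambda>F. l2_inner W (orth_proj W M (D (Rep_ell2 F))) (Rep_ell2 F)) has_sum
      of_real (\<Sum>a\<in>A. (norm (cproj ?M (e a)))\<^sup>2)) B'"
    by (simp cong: has_sum_cong)
  then have "((\<lambda>f. l2_inner W (orth_proj W M (D f)) f) has_sum
      of_real (\<Sum>a\<in>A. (norm (cproj ?M (e a)))\<^sup>2)) (Rep_ell2 ` B')"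
    by (subst has_sum_reindex) (auto simp: inj_on_def Rep_ell2_inject o_def)
  then show ?thesis
    unfolding trace_op_def B_def[symmetric] BB' by (rule infsumI)
qed

section \<open>Averages over simplices\<close>

definition degrees_upto :: "nat \<Rightarrow> nat \<Rightarrow> (nat \<Rightarrow> nat) set"
  where "degrees_upto k r = {q \<in> {1..k} \<rightarrow>\<^sub>E UNIV. (\<Sum>i\<in>{1..k}. q i) \<le> r}"

text \<open>A degree \<open>s\<close> in the last position leaves the budget \<open>r - s\<close>
  for the others. The inverse resets that position to \<open>undefined\<close> because members of
  \<open>degrees_upto k\<close> are extensional on \<open>{1..k}\<close>.\<close>

lemma bij_betw_degrees_upto_Suc:
  "bij_betw (\<lambda>(s, q). q(Suc k := s)) (SIGMA s:{..r}. degrees_upto k (r - s)) (degrees_upto (Suc k) r)"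
proof (rule bij_betw_byWitness[where f' = "\<lambda>q. (q (Suc k), q(Suc k := undefined))"])
  have upd: "(\<Sum>i\<in>{1..k}. (q(Suc k := s)) i) = (\<Sum>i\<in>{1..k}. q i)" for q :: "nat \<Rightarrow> nat" and s
    by (intro sum.cong) auto
  show "\<forall>a\<in>SIGMA s:{..r}. degrees_upto k (r - s).
      (\<lambda>q. (q (Suc k), q(Suc k := undefined))) ((\<lambda>(s, q). q(Suc k := s)) a) = a"
    by (auto simp: degrees_upto_def PiE_def extensional_def fun_eq_iff)
  show "\<forall>a'\<in>degrees_upto (Suc k) r.
      (\<lambda>(s, q). q(Suc k := s)) ((\<lambda>q. (q (Suc k), q(Suc k := undefined))) a') = a'"
    by (auto simp: degrees_upto_def)
  show "(\<lambda>(s, q). q(Suc k := s)) ` (SIGMA s:{..r}. degrees_upto k (r - s)) \<subseteq> degrees_upto (Suc k) r"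
    using upd by (auto simp: degrees_upto_def PiE_def extensional_def)
  show "(\<lambda>q. (q (Suc k), q(Suc k := undefined))) ` degrees_upto (Suc k) r \<subseteq> (SIGMA s:{..r}. degrees_upto k (r - s))"
    using upd by (auto simp: degrees_upto_def PiE_def extensional_def)
qed

lemma finite_degrees_upto: "finite (degrees_upto k r)"
proof (induction k arbitrary: r)
  case (Suc k)
  have "finite (SIGMA s:{..r}. degrees_upto k (r - s))" using Suc by simp
  then show ?case using bij_betw_finite[OF bij_betw_degrees_upto_Suc] by blast
qed (simp add: degrees_upto_def)

text \<open>Splitting off the last degree turns the count into a hockey-stick sum of binomials. The
  result is the normalizing factor of the multiplicity, which is therefore a true average.\<close>

lemma card_degrees_upto: "card (degrees_upto k r) = (r + k) choose k"
proof (induction k arbitrary: r)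
  case (Suc k)
  have "card (degrees_upto (Suc k) r) = card (SIGMA s:{..r}. degrees_upto k (r - s))"
    using bij_betw_same_card[OF bij_betw_degrees_upto_Suc] by simp
  also have "\<dots> = (\<Sum>s\<le>r. (r - s + k) choose k)"
    using finite_degrees_upto Suc by simp
  also have "\<dots> = (\<Sum>s\<le>r. (s + k) choose k)"
    by (rule sum.reindex_bij_witness[of _ "\<lambda>s. r - s" "\<lambda>s. r - s"]) auto
  also have "\<dots> = (\<Sum>s\<le>r. (k + s) choose s)"
    by (intro sum.cong refl) (metis add.commute add_diff_cancel_right' binomial_symmetric le_add2)
  also have "\<dots> = Suc (k + r) choose r" by (rule sum_choose_lower)
  also have "\<dots> = (r + Suc k) choose Suc k"
    using binomial_symmetric[of r "r + Suc k"] by (simp add: add.commute)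
  finally show ?case .
qed (simp add: degrees_upto_def)

text \<open>The quotient is a product of \<open>s\<close> consecutive quotients, each of the form (r
  + t + 1) / (r + t + 1 + k) with t below \<open>s\<close>, and each tends to 1. It measures the
  proportion of a simplex that a fixed translation retains.\<close>

lemma binomial_shift_quotient_tendsto:
  "(\<lambda>r. real ((r + k) choose k) / real ((r + s + k) choose k)) \<longlonglongrightarrow> 1"
proof (induction s)
  case (Suc s)
  have "real ((r + s + k) choose k) / real ((r + Suc s + k) choose k) = real (Suc (r + s)) / real (Suc (r + s + k))" for r
  proof -
    have "Suc (r + s) * (Suc (r + s + k) choose k) = Suc (r + s + k) * ((r + s + k) choose k)"
      using binomial_absorb_comp[of "Suc (r + s + k)" k] by (simp add: Suc_diff_le)
    then have "real (Suc (r + s)) * real (Suc (r + s + k) choose k) = real (Suc (r + s + k)) * real ((r + s + k) choose k)"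
      by (metis of_nat_mult)
    then show ?thesis by (simp add: field_simps del: of_nat_Suc)
  qed
  moreover have "(\<lambda>r. real (Suc (r + s)) / real (Suc (r + s + k))) \<longlonglongrightarrow> 1"
  proof -
    have "(\<lambda>r. 1 / (1 + real k * inverse (real (Suc (r + s))))) \<longlonglongrightarrow> 1 / (1 + real k * 0)"
      by (intro tendsto_intros LIMSEQ_ignore_initial_segment[OF LIMSEQ_inverse_real_of_nat]) simp
    moreover have "1 / (1 + real k * inverse (real (Suc (r + s)))) = real (Suc (r + s)) / real (Suc (r + s + k))" for r
      by (simp add: field_simps)
    ultimately show ?thesis by simp
  qed
  ultimately have "(\<lambda>r. real ((r + s + k) choose k) / real ((r + Suc s + k) choose k)) \<longlonglongrightarrow> 1"
    by simp
  from tendsto_mult[OF Suc.IH this] show ?case by simp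
qed simp

section \<open>Averages of functions that are nondecreasing in each degree\<close>

context
  fixes k :: nat and a :: "(nat \<Rightarrow> nat) \<Rightarrow> real"
  assumes a_step: "\<And>q i. q \<in> {1..k} \<rightarrow>\<^sub>E UNIV \<Longrightarrow> i \<in> {1..k} \<Longrightarrow> a q \<le> a (q(i := Suc (q i)))"
begin

definition add_degree :: "(nat \<Rightarrow> nat) \<Rightarrow> (nat \<Rightarrow> nat) \<Rightarrow> nat \<Rightarrow> nat"
  where "add_degree p q = (\<lambda>i\<in>{1..k}. p i + q i)"

text \<open>Induction on the total degree of \<open>q\<close>: one unit is removed at a position
  where \<open>q\<close> is nonzero and restored by a single application of
  \<open>a_step\<close>.\<close>

lemma le_add_degree:
  assumes p: "p \<in> {1..k} \<rightarrow>\<^sub>E UNIV"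
  shows "a p \<le> a (add_degree p q)"
proof (induction "\<Sum>i\<in>{1..k}. q i" arbitrary: q)
  case 0
  then have "add_degree p q = p" using p by (auto simp: add_degree_def fun_eq_iff PiE_def extensional_def)
  then show ?case by simp
next
  case (Suc s)
  then obtain i where i: "i \<in> {1..k}" "q i \<noteq> 0" by (metis nat.distinct(1) sum.neutral)
  define q' where "q' = q(i := q i - 1)"
  have "(\<Sum>j\<in>{1..k}. q j) = q i + (\<Sum>j\<in>{1..k} - {i}. q j)"
    "(\<Sum>j\<in>{1..k}. q' j) = q' i + (\<Sum>j\<in>{1..k} - {i}. q' j)"
    using i(1) by (intro sum.remove; simp)+
  moreover have "(\<Sum>j\<in>{1..k} - {i}. q' j) = (\<Sum>j\<in>{1..k} - {i}. q j)"
    by (intro sum.cong) (auto simp: q'_def)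
  ultimately have "s = (\<Sum>j\<in>{1..k}. q' j)" using Suc(2) i(2) by (simp add: q'_def)
  then have "a p \<le> a (add_degree p q')" by (rule Suc(1))
  also have "\<dots> \<le> a ((add_degree p q')(i := Suc (add_degree p q' i)))"
    using i(1) by (intro a_step) (auto simp: add_degree_def)
  also have "(add_degree p q')(i := Suc (add_degree p q' i)) = add_degree p q"
    using i by (auto simp: add_degree_def q'_def fun_eq_iff)
  finally show ?case .
qed

text \<open>The translate by \<open>p\<close> of the simplex of size \<open>r\<close> sits inside
  the simplex of size \<open>r\<close> plus the total degree of \<open>p\<close>. On the translate
  every value is at least \<open>a p\<close>, and the remaining terms are nonnegative.\<close>

lemma sum_degrees_upto_ge:
  assumes p: "p \<in> {1..k} \<rightarrow>\<^sub>E UNIV" and nonneg: "\<And>q. q \<in> {1..k} \<rightarrow>\<^sub>E UNIV \<Longrightarrow> 0 \<le> a q"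
  shows "real ((r + k) choose k) * a p \<le> (\<Sum>q\<in>degrees_upto k (r + (\<Sum>i\<in>{1..k}. p i)). a q)"
proof -
  have inj: "inj_on (add_degree p) (degrees_upto k r)"
    by (intro inj_onI ext) (auto simp: add_degree_def degrees_upto_def fun_eq_iff PiE_def extensional_def, metis add_left_cancel atLeastAtMost_iff restrict_apply)
  have sub: "add_degree p ` degrees_upto k r \<subseteq> degrees_upto k (r + (\<Sum>i\<in>{1..k}. p i))"
    by (auto simp: add_degree_def degrees_upto_def sum.distrib)
  have "real ((r + k) choose k) * a p = (\<Sum>q\<in>add_degree p ` degrees_upto k r. a p)"
    using card_image[OF inj] by (simp add: card_degrees_upto)
  also have "\<dots> \<le> (\<Sum>q\<in>add_degree p ` degrees_upto k r. a q)"
    using le_add_degree[OF p] by (intro sum_mono) auto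
  also have "\<dots> \<le> (\<Sum>q\<in>degrees_upto k (r + (\<Sum>i\<in>{1..k}. p i)). a q)"
    using sub by (intro sum_mono2 finite_degrees_upto nonneg) (auto simp: degrees_upto_def)
  finally show ?thesis .
qed

lemma degrees_upto_average_tendsto_SUP:
  assumes nonneg: "\<And>q. q \<in> {1..k} \<rightarrow>\<^sub>E UNIV \<Longrightarrow> 0 \<le> a q"
    and bdd: "bdd_above (a ` ({1..k} \<rightarrow>\<^sub>E UNIV))"
  shows "(\<lambda>r. (1 / real ((r + k) choose k)) * (\<Sum>q\<in>degrees_upto k r. a q))
    \<longlonglongrightarrow> (SUP q\<in>{1..k} \<rightarrow>\<^sub>E UNIV. a q)" (is "?avg \<longlonglongrightarrow> ?S")
proof (rule order_tendstoI)
  fix y assume "?S < y"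
  have "?avg r \<le> ?S" for r
  proof -
    have "(\<Sum>q\<in>degrees_upto k r. a q) \<le> (\<Sum>q\<in>degrees_upto k r. ?S)"
      by (intro sum_mono cSUP_upper bdd) (auto simp: degrees_upto_def)
    also have "\<dots> = real ((r + k) choose k) * ?S" by (simp add: card_degrees_upto)
    finally show ?thesis by (simp add: field_simps)
  qed
  with \<open>?S < y\<close> show "eventually (\<lambda>r. ?avg r < y) sequentially"
    by (intro always_eventually allI) (rule order_le_less_trans)
next
  fix y assume "y < ?S"
  \<comment> \<open>A single multi-index \<open>p\<close> already beats \<open>y\<close>; its
    translated simplex dominates the averages for large \<open>r\<close>.\<close>
  then obtain p where p: "p \<in> {1..k} \<rightarrow>\<^sub>E UNIV" "y < a p"
    using less_cSUP_iff[OF _ bdd, of y] by (metis PiE_eq_empty_iff UNIV_not_empty)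
  let ?s = "\<Sum>i\<in>{1..k}. p i"
  have "(\<lambda>r. real ((r + k) choose k) / real ((r + ?s + k) choose k) * a p) \<longlonglongrightarrow> 1 * a p"
    by (intro tendsto_mult binomial_shift_quotient_tendsto tendsto_const)
  then have "eventually (\<lambda>r. y < real ((r + k) choose k) / real ((r + ?s + k) choose k) * a p) sequentially"
    using p(2) by (intro order_tendstoD) auto
  moreover have "real ((r + k) choose k) / real ((r + ?s + k) choose k) * a p \<le> ?avg (r + ?s)" for r
    using sum_degrees_upto_ge[OF p(1) nonneg, of r] by (simp add: divide_right_mono)
  ultimately have "eventually (\<lambda>r. y < ?avg (r + ?s)) sequentially"
    by (auto elim!: eventually_mono intro: order_less_le_trans)
  then show "eventually (\<lambda>r. y < ?avg r) sequentially" by (rule eventually_sequentially_seg[THEN iffD1])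
qed

end

section \<open>The elementary tensors\<close>

lemma l2_inner_fock_vec:
  assumes "\<alpha> \<in> W"
  shows "l2_inner W f (fock_vec \<alpha> x) = cinner (f \<alpha>) x"
proof -
  have "l2_inner W f (fock_vec \<alpha> x) = (\<Sum>\<^sub>\<infinity>w\<in>{\<alpha>}. cinner (f w) (fock_vec \<alpha> x w))"
    unfolding l2_inner_def using assms by (intro infsum_cong_neutral) (auto simp: fock_vec_def)
  then show ?thesis by (simp add: fock_vec_def)
qed

lemma fock_vec_in_l2:
  assumes "\<alpha> \<in> W"
  shows "fock_vec \<alpha> x \<in> l2 W"
proof -
  have "(\<lambda>w. (norm (fock_vec \<alpha> x w))\<^sup>2) summable_on W \<longleftrightarrow>
      (\<lambda>w. (norm (fock_vec \<alpha> x w))\<^sup>2) summable_on {\<alpha>}"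
    using assms by (intro summable_on_cong_neutral) (auto simp: fock_vec_def)
  with assms show ?thesis by (auto simp: l2_def fock_vec_def)
qed

definition tensor_vec :: "(nat \<Rightarrow> nat list) \<Rightarrow> 'e::complex_inner \<Rightarrow> (nat \<Rightarrow> nat list, 'e) ell2"
  where "tensor_vec \<alpha> x = Abs_ell2 (fock_vec \<alpha> x)"

lemma Rep_tensor_vec: "Rep_ell2 (tensor_vec \<alpha> x) = fock_vec \<alpha> x"
  unfolding tensor_vec_def by (intro Abs_ell2_inverse fock_vec_in_l2) simp

lemma cinner_tensor_vec: "cinner F (tensor_vec \<alpha> x) = cinner (Rep_ell2 F \<alpha>) x"
  by (simp add: cinner_ell2.rep_eq Rep_tensor_vec l2_inner_fock_vec)

lemma norm_tensor_vec: "norm (tensor_vec \<alpha> x) = norm x"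
proof -
  have "complex_of_real ((norm (tensor_vec \<alpha> x))\<^sup>2) = of_real ((norm x)\<^sup>2)"
    unfolding cinner_self[symmetric] by (simp add: cinner_tensor_vec Rep_tensor_vec fock_vec_def)
  then show ?thesis by (simp only: of_real_eq_iff) (simp add: power2_eq_iff_nonneg)
qed

text \<open>Elementary tensors with second factor in \<open>X\<close> form a basis. It serves only
  to guarantee that the \<open>SOME\<close> in \<open>trace_op\<close> picks a basis; the trace
  itself is not evaluated on it.\<close>

lemma ex_orthonormal_basis:
  assumes X: "orthonormal X" "\<And>x :: 'e::complex_inner. x = (\<Sum>e\<in>X. cinner x e *\<^sub>C e)"
  shows "\<exists>B :: ((nat \<Rightarrow> nat list) \<Rightarrow> 'e) set. orthonormal_basis W B"
proof
  define B where "B = (\<lambda>(\<alpha>, x). fock_vec \<alpha> x) ` (W \<times> X)"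
  show "orthonormal_basis W B"
    unfolding orthonormal_basis_def
  proof (intro conjI ballI impI)
    show "B \<subseteq> l2 W" by (auto simp: B_def fock_vec_in_l2)
    fix b b' assume "b \<in> B" "b' \<in> B"
    then obtain \<alpha> x \<beta> y where b: "b = fock_vec \<alpha> x" "\<alpha> \<in> W" "x \<in> X" and b': "b' = fock_vec \<beta> y" "\<beta> \<in> W" "y \<in> X"
      by (auto simp: B_def)
    \<comment> \<open>A nonzero \<open>x\<close> lets \<open>\<alpha>\<close> and \<open>x\<close>
      be recovered from \<open>fock_vec \<alpha> x\<close>, so distinct pairs give distinct basis
      vectors.\<close>
    have "x \<noteq> 0" using b(3) orthonormal_norm[OF X(1)] by fastforce
    then have "b = b' \<longleftrightarrow> \<alpha> = \<beta> \<and> x = y"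
      unfolding b b' fock_vec_def by metis
    moreover have "l2_inner W b b' = (if \<alpha> = \<beta> then cinner x y else 0)"
      using b b' by (simp add: l2_inner_fock_vec) (simp add: fock_vec_def)
    ultimately show "l2_inner W b b' = (if b = b' then 1 else 0)"
      using X(1) b(3) b'(3) by (auto simp: orthonormal_def)
  next
    fix f :: "(nat \<Rightarrow> nat list) \<Rightarrow> 'e" assume f: "f \<in> l2 W" "\<forall>b\<in>B. l2_inner W f b = 0"
    have "f w = 0" for w
    proof (cases "w \<in> W")
      case True
      then have "cinner (f w) x = 0" if "x \<in> X" for x
        using f(2) that l2_inner_fock_vec[OF True, of f x] by (auto simp: B_def)
      then show ?thesis using X(2)[of "f w"] by simp
    qed (use f(1) in \<open>auto simp: l2_def\<close>)
    then show "f = (\<lambda>w. 0)" by blast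
  qed
qed

section \<open>Words of a fixed multi-degree\<close>

definition words_of_degree :: "nat \<Rightarrow> (nat \<Rightarrow> nat) \<Rightarrow> (nat \<Rightarrow> nat) \<Rightarrow> (nat \<Rightarrow> nat list) set"
  where "words_of_degree k n q = {\<alpha> \<in> multiwords k n. \<forall>i\<in>{1..k}. length (\<alpha> i) = q i}"

lemma words_of_degree_eq_PiE:
  "words_of_degree k n q = (\<Pi>\<^sub>E i\<in>{1..k}. {xs. set xs \<subseteq> {1..n i} \<and> length xs = q i})"
  unfolding words_of_degree_def multiwords_def lists_eq_set by (auto simp: PiE_def Pi_def)

lemma multiwords_upd:
  assumes "\<alpha> \<in> multiwords k n" "i \<in> {1..k}" "set xs \<subseteq> {1..n i}"
  shows "\<alpha>(i := xs) \<in> multiwords k n"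
  using assms unfolding multiwords_def lists_eq_set by (simp add: PiE_iff extensional_def)

lemma multiwordsD: "\<alpha> \<in> multiwords k n \<Longrightarrow> i \<in> {1..k} \<Longrightarrow> set (\<alpha> i) \<subseteq> {1..n i}"
  unfolding multiwords_def lists_eq_set by (drule (1) PiE_mem) simp

lemma multiwords_Cons:
  assumes "\<alpha> \<in> multiwords k n" "i \<in> {1..k}" "j \<in> {1..n i}"
  shows "\<alpha>(i := j # \<alpha> i) \<in> multiwords k n"
  using assms multiwordsD[OF assms(1,2)] by (intro multiwords_upd) auto

lemma words_of_degreeD:
  assumes "\<alpha> \<in> words_of_degree k n q"
  shows "\<alpha> \<in> multiwords k n" "i \<in> {1..k} \<Longrightarrow> length (\<alpha> i) = q i"
  using assms by (auto simp: words_of_degree_def)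

lemma finite_words_of_degree: "finite (words_of_degree k n q)"
  unfolding words_of_degree_eq_PiE by (intro finite_PiE finite_lists_length_eq) auto

lemma card_words_of_degree: "card (words_of_degree k n q) = (\<Prod>i\<in>{1..k}. n i ^ q i)"
  unfolding words_of_degree_eq_PiE by (simp add: card_PiE card_lists_length_eq)

text \<open>A nonempty word splits uniquely into its first letter and the rest, so the tuples of
  raised degree are the disjoint images of the tuples of degree \<open>q\<close> under prefixing
  each of the \<open>n i\<close> letters in position \<open>i\<close>.\<close>

lemma sum_words_of_degree_Suc:
  assumes i: "i \<in> {1..k}"
  shows "(\<Sum>\<alpha>\<in>words_of_degree k n (q(i := Suc (q i))). f \<alpha>) =
    (\<Sum>j\<in>{1..n i}. \<Sum>\<alpha>\<in>words_of_degree k n q. f (\<alpha>(i := j # \<alpha> i)))"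
proof -
  let ?W = "words_of_degree k n (q(i := Suc (q i)))"
  have shape: "\<alpha> i = hd (\<alpha> i) # tl (\<alpha> i)" if "\<alpha> \<in> ?W" for \<alpha>
    using words_of_degreeD(2)[OF that i] by (cases "\<alpha> i") simp_all
  have "(\<Sum>\<alpha>\<in>?W. f \<alpha>) = (\<Sum>(j, \<alpha>)\<in>{1..n i} \<times> words_of_degree k n q. f (\<alpha>(i := j # \<alpha> i)))"
  proof (rule sum.reindex_bij_witness[of _ "\<lambda>(j, \<alpha>). \<alpha>(i := j # \<alpha> i)" "\<lambda>\<alpha>. (hd (\<alpha> i), \<alpha>(i := tl (\<alpha> i)))"])
    fix \<alpha> assume \<alpha>: "\<alpha> \<in> ?W"
    note sh = shape[OF \<alpha>]
    then show "(\<lambda>(j, \<alpha>). \<alpha>(i := j # \<alpha> i)) (hd (\<alpha> i), \<alpha>(i := tl (\<alpha> i))) = \<alpha>"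
      by (simp add: fun_eq_iff)
    then show "(\<lambda>(j, \<alpha>). f (\<alpha>(i := j # \<alpha> i))) (hd (\<alpha> i), \<alpha>(i := tl (\<alpha> i))) = f \<alpha>"
      by simp
    have "set (hd (\<alpha> i) # tl (\<alpha> i)) \<subseteq> {1..n i}"
      using multiwordsD[OF words_of_degreeD(1)[OF \<alpha>] i] sh by metis
    then have "hd (\<alpha> i) \<in> {1..n i}" "\<alpha>(i := tl (\<alpha> i)) \<in> multiwords k n"
      by (auto intro!: multiwords_upd[OF words_of_degreeD(1)[OF \<alpha>] i])
    moreover have "length ((\<alpha>(i := tl (\<alpha> i))) l) = q l" if "l \<in> {1..k}" for l
      using words_of_degreeD(2)[OF \<alpha> that] by (auto split: if_splits)
    ultimately show "(hd (\<alpha> i), \<alpha>(i := tl (\<alpha> i))) \<in> {1..n i} \<times> words_of_degree k n q"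
      by (simp add: words_of_degree_def)
  next
    fix p assume "p \<in> {1..n i} \<times> words_of_degree k n q"
    then obtain j \<alpha> where p: "p = (j, \<alpha>)" "j \<in> {1..n i}" "\<alpha> \<in> words_of_degree k n q" by blast
    have "length ((\<alpha>(i := j # \<alpha> i)) l) = (q(i := Suc (q i))) l" if "l \<in> {1..k}" for l
      using words_of_degreeD(2)[OF p(3) that] by auto
    with p multiwords_Cons[OF words_of_degreeD(1)[OF p(3)] i p(2)]
    show "(case p of (j, \<alpha>) \<Rightarrow> \<alpha>(i := j # \<alpha> i)) \<in> ?W"
      by (simp add: words_of_degree_def)
  qed auto
  then show ?thesis by (simp add: sum.cartesian_product)
qed

lemma card_words_of_degree_Suc:
  assumes "i \<in> {1..k}"
  shows "card (words_of_degree k n (q(i := Suc (q i)))) = n i * card (words_of_degree k n q)"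
  using sum_words_of_degree_Suc[OF assms, where f = "\<lambda>_. 1 :: nat"] by simp

section \<open>Traces of the degree projections\<close>

lemma degree_proj_Rep_ell2:
  assumes X: "finite X" "\<And>x :: 'e::complex_inner. x = (\<Sum>e\<in>X. cinner x e *\<^sub>C e)"
    and F: "Rep_ell2 F \<in> l2 (multiwords k n)"
  shows "degree_proj k q (Rep_ell2 F) = Rep_ell2 (\<Sum>(\<alpha>, x)\<in>words_of_degree k n q \<times> X.
    cinner F (tensor_vec \<alpha> x) *\<^sub>C tensor_vec \<alpha> x)"
proof
  fix w
  let ?W = "words_of_degree k n q"
  have "Rep_ell2 (\<Sum>(\<alpha>, x)\<in>?W \<times> X. cinner F (tensor_vec \<alpha> x) *\<^sub>C tensor_vec \<alpha> x) w =
      (\<Sum>\<alpha>\<in>?W. \<Sum>x\<in>X. cinner (Rep_ell2 F \<alpha>) x *\<^sub>C fock_vec \<alpha> x w)"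
    by (simp add: sum.cartesian_product[symmetric] Rep_ell2_sum scaleC_ell2.rep_eq Rep_tensor_vec cinner_tensor_vec)
  also have "\<dots> = (\<Sum>\<alpha>\<in>?W. if \<alpha> = w then Rep_ell2 F w else 0)"
  proof (intro sum.cong refl)
    fix \<alpha>
    show "(\<Sum>x\<in>X. cinner (Rep_ell2 F \<alpha>) x *\<^sub>C fock_vec \<alpha> x w) = (if \<alpha> = w then Rep_ell2 F w else 0)"
      using X(2)[of "Rep_ell2 F w"] by (simp add: fock_vec_def)
  qed
  also have "\<dots> = (if w \<in> ?W then Rep_ell2 F w else 0)"
    using finite_words_of_degree by simp
  \<comment> \<open>\<open>degree_proj\<close> tests lengths only; index tuples that are not in
    \<open>multiwords k n\<close> drop out because \<open>F\<close> vanishes there.\<close>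
  also have "\<dots> = degree_proj k q (Rep_ell2 F) w"
    using F by (auto simp: degree_proj_def words_of_degree_def l2_def)
  finally show "degree_proj k q (Rep_ell2 F) w = Rep_ell2 (\<Sum>(\<alpha>, x)\<in>?W \<times> X.
    cinner F (tensor_vec \<alpha> x) *\<^sub>C tensor_vec \<alpha> x) w" by simp
qed

definition degree_trace ::
    "'e::complex_inner set \<Rightarrow> nat \<Rightarrow> (nat \<Rightarrow> nat) \<Rightarrow> ((nat \<Rightarrow> nat list) \<Rightarrow> 'e) set \<Rightarrow> (nat \<Rightarrow> nat) \<Rightarrow> real"
  where "degree_trace X k n M q =
    (\<Sum>\<alpha>\<in>words_of_degree k n q. \<Sum>x\<in>X. (norm (cproj {F. Rep_ell2 F \<in> M} (tensor_vec \<alpha> x)))\<^sup>2)"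

lemma trace_op_degree_proj:
  fixes M :: "((nat \<Rightarrow> nat list) \<Rightarrow> 'e::complex_inner) set"
  assumes M: "closed_subspace (multiwords k n) M" and complete: "complete (UNIV :: 'e set)"
    and X: "finite X" "orthonormal X" "\<And>x :: 'e. x = (\<Sum>e\<in>X. cinner x e *\<^sub>C e)"
  shows "trace_op (multiwords k n) (\<lambda>f. orth_proj (multiwords k n) M (degree_proj k q f)) =
    of_real (degree_trace X k n M q)"
proof -
  let ?A = "words_of_degree k n q \<times> X" and ?e = "\<lambda>(\<alpha>, x). tensor_vec \<alpha> x"
  have "trace_op (multiwords k n) (\<lambda>f. orth_proj (multiwords k n) M (degree_proj k q f)) =
      of_real (\<Sum>a\<in>?A. (norm (cproj {F. Rep_ell2 F \<in> M} (?e a)))\<^sup>2)"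
  proof (rule trace_op_orth_proj[OF M complete ex_orthonormal_basis[OF X(2,3)]])
    show "Rep_ell2 (?e a) \<in> l2 (multiwords k n)" if "a \<in> ?A" for a
      using that by (auto simp: Rep_tensor_vec words_of_degree_def intro: fock_vec_in_l2)
    show "degree_proj k q (Rep_ell2 F) = Rep_ell2 (\<Sum>a\<in>?A. cinner F (?e a) *\<^sub>C ?e a)"
      if "Rep_ell2 F \<in> l2 (multiwords k n)" for F :: "(nat \<Rightarrow> nat list, 'e) ell2"
      using degree_proj_Rep_ell2[OF X(1,3) that, of q] by (simp add: case_prod_unfold)
  qed
  then show ?thesis by (simp add: degree_trace_def sum.cartesian_product case_prod_unfold)
qed

lemma cproj_ident:
  assumes "csubspace M" "x \<in> M"
  shows "cproj M x = x"
  using assms by (intro cproj_eqI) auto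

lemma degree_proj_l2:
  assumes "f \<in> l2 W"
  shows "degree_proj k q f \<in> l2 W"
proof -
  have "(\<lambda>w. (norm (f w))\<^sup>2) summable_on W" using assms by (simp add: l2_def)
  then have "(\<lambda>w. (norm (degree_proj k q f w))\<^sup>2) summable_on W"
    by (rule summable_on_comparison_test) (simp_all add: degree_proj_def)
  with assms show ?thesis by (simp add: l2_def degree_proj_def)
qed

text \<open>The projection onto the whole space is inserted, which is the identity there, so that
  the formula for compressed traces applies; every unit tensor of the given degree then contributes
  1.\<close>

lemma trace_op_degree_proj_scalar:
  "trace_op (multiwords k n) (degree_proj k q :: ((nat \<Rightarrow> nat list) \<Rightarrow> complex) \<Rightarrow> _) =
    of_nat (card (words_of_degree k n q))"
proof -
  let ?W = "multiwords k n"
  let ?M = "l2 ?W :: ((nat \<Rightarrow> nat list) \<Rightarrow> complex) set"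
  have X: "finite {1 :: complex}" "orthonormal {1 :: complex}"
    "\<And>x :: complex. x = (\<Sum>e\<in>{1}. cinner x e *\<^sub>C e)"
    by (auto simp: orthonormal_def cinner_complex_def scaleC_complex_def)
  have compl: "complete (UNIV :: complex set)" by (rule complete_UNIV)
  have ob: "orthonormal_basis ?W (SOME B :: ((nat \<Rightarrow> nat list) \<Rightarrow> complex) set. orthonormal_basis ?W B)"
    using ex_orthonormal_basis[OF X(2,3)] by (rule someI_ex)
  have ident: "orth_proj ?W ?M f = f" if f: "f \<in> ?M" for f
  proof -
    obtain F where F: "f = Rep_ell2 F" using f by (rule l2E)
    then show ?thesis
      using f orth_proj_Rep_ell2[OF closed_subspace_l2 compl, of F ?W]
      by (simp add: cproj_ident csubspace_Rep_ell2[OF closed_subspace_l2])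
  qed
  have "trace_op ?W (degree_proj k q :: ((nat \<Rightarrow> nat list) \<Rightarrow> complex) \<Rightarrow> _) =
      trace_op ?W (\<lambda>f. orth_proj ?W ?M (degree_proj k q f))"
    unfolding trace_op_def
  proof (rule infsum_cong)
    fix b assume "b \<in> (SOME B :: ((nat \<Rightarrow> nat list) \<Rightarrow> complex) set. orthonormal_basis ?W B)"
    with ob have "b \<in> ?M" unfolding orthonormal_basis_def by blast
    then show "l2_inner ?W (degree_proj k q b) b = l2_inner ?W (orth_proj ?W ?M (degree_proj k q b)) b"
      by (simp only: ident degree_proj_l2)
  qed
  also have "\<dots> = of_real (degree_trace {1} k n ?M q)"
    by (rule trace_op_degree_proj[OF closed_subspace_l2 compl X])
  also have "degree_trace {1} k n ?M q = (\<Sum>\<alpha>\<in>words_of_degree k n q. 1)"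
    unfolding degree_trace_def
  proof (intro sum.cong refl)
    fix \<alpha> assume "\<alpha> \<in> words_of_degree k n q"
    then have "fock_vec \<alpha> (1 :: complex) \<in> ?M"
      by (intro fock_vec_in_l2) (simp add: words_of_degree_def)
    then show "(\<Sum>x\<in>{1 :: complex}. (norm (cproj {F. Rep_ell2 F \<in> ?M} (tensor_vec \<alpha> x)))\<^sup>2) = 1"
      using cproj_ident[OF csubspace_Rep_ell2[OF closed_subspace_l2, where W = ?W], of "tensor_vec \<alpha> (1 :: complex)"]
      by (simp add: norm_tensor_vec Rep_tensor_vec)
  qed
  finally show ?thesis by simp
qed

section \<open>Monotonicity in the degree\<close>

text \<open>Prefixing \<open>j\<close> in position \<open>i\<close> is injective on index tuples and
  a created vector is supported on its image, so reindexing carries one inner product to the other: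
  creation operators are isometries.\<close>

lemma l2_inner_creation:
  fixes f g :: "(nat \<Rightarrow> nat list) \<Rightarrow> 'a::complex_inner"
  assumes i: "i \<in> {1..k}" and j: "j \<in> {1..n i}"
  shows "l2_inner (multiwords k n) (creation i j f) (creation i j g) = l2_inner (multiwords k n) f g"
proof -
  let ?W = "multiwords k n" and ?\<phi> = "\<lambda>\<alpha> :: nat \<Rightarrow> nat list. \<alpha>(i := j # \<alpha> i)"
  have sub: "?\<phi> ` ?W \<subseteq> ?W"
    using i j multiwords_Cons by blast
  have in_img: "w \<in> ?\<phi> ` ?W" if w: "w \<in> ?W" and ne: "creation i j h w \<noteq> 0" for w and h :: "(nat \<Rightarrow> nat list) \<Rightarrow> 'a"
  proof -
    obtain \<beta> where \<beta>: "w i = j # \<beta>"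
      using ne by (auto simp: creation_def split: list.splits if_splits)
    have "w(i := \<beta>) \<in> ?W" 
      using multiwordsD[OF w i] \<beta> by (intro multiwords_upd w i) auto
    moreover have "w = ?\<phi> (w(i := \<beta>))" using \<beta> by (auto simp: fun_eq_iff)
    ultimately show ?thesis by blast
  qed
  have inj: "inj_on ?\<phi> ?W"
    by (rule inj_on_inverseI[where g = "\<lambda>\<alpha>. \<alpha>(i := tl (\<alpha> i))"]) simp
  have "l2_inner ?W (creation i j f) (creation i j g) =
      (\<Sum>\<^sub>\<infinity>w\<in>?\<phi> ` ?W. cinner (creation i j f w) (creation i j g w))"
    unfolding l2_inner_def
  proof (intro infsum_cong_neutral)
    show "cinner (creation i j f w) (creation i j g w) = 0" if "w \<in> ?W - ?\<phi> ` ?W" for w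
    proof -
      have "creation i j f w = 0" using in_img[of w f] that by blast
      then show ?thesis by simp
    qed
  qed (use sub in auto)
  also have "\<dots> = l2_inner ?W f g"
    by (subst infsum_reindex[OF inj]) (simp add: o_def l2_inner_def creation_def)
  finally show ?thesis .
qed

context
  fixes k :: nat and n :: "nat \<Rightarrow> nat" and M :: "((nat \<Rightarrow> nat list) \<Rightarrow> 'e::complex_inner) set"
  assumes M: "invariant_subspace k n M" and complete: "complete (UNIV :: 'e set)"
begin

lemma norm_cproj_tensor_vec_mono:
  assumes i: "i \<in> {1..k}" and j: "j \<in> {1..n i}" and \<alpha>: "\<alpha> \<in> multiwords k n"
  shows "norm (cproj {F. Rep_ell2 F \<in> M} (tensor_vec \<alpha> x)) \<le>
    norm (cproj {F. Rep_ell2 F \<in> M} (tensor_vec (\<alpha>(i := j # \<alpha> i)) x))"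
proof -
  let ?W = "multiwords k n" and ?M = "{F. Rep_ell2 F \<in> M}"
  have cl: "closed_subspace ?W M" and inv: "creation i j ` M \<subseteq> M"
    using M i j by (auto simp: invariant_subspace_def)
  have sub: "M \<subseteq> l2 ?W" using cl by (simp add: closed_subspace_def)
  note M' = csubspace_Rep_ell2[OF cl] complete_Rep_ell2[OF cl complete]
  let ?p = "cproj ?M (tensor_vec \<alpha> x)"
  have p: "Rep_ell2 ?p \<in> M" using cproj_in[OF M'] by blast
  then have Sp: "creation i j (Rep_ell2 ?p) \<in> M" using inv by blast
  then obtain P where P: "creation i j (Rep_ell2 ?p) = Rep_ell2 P" using sub l2E by blast
  \<comment> \<open>Isometry against the fixed vector \<open>P\<close>, the created image of the
    projection \<open>?p\<close>. It is used for the elementary tensor and its image, and for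
    \<open>?p\<close> and \<open>P\<close> themselves, where it yields equality of norms.\<close>
  have inner: "cinner G' P = cinner G ?p"
    if "creation i j (Rep_ell2 G) = Rep_ell2 G'" "Rep_ell2 G \<in> l2 ?W" "Rep_ell2 G' \<in> l2 ?W" for G G'
    using l2_inner_creation[of i k j n "Rep_ell2 G" "Rep_ell2 ?p"] i j that
    by (simp add: P l2_inner_Rep_ell2)
  show ?thesis
  proof (rule norm_cproj_mono[OF M'])
    show "P \<in> ?M" using Sp P by simp
    have "\<alpha>(i := j # \<alpha> i) \<in> ?W"
      using \<alpha> i j by (rule multiwords_Cons)
    then show "cinner (tensor_vec (\<alpha>(i := j # \<alpha> i)) x) P = cinner (tensor_vec \<alpha> x) ?p"
      using \<alpha> by (intro inner) (simp_all add: Rep_tensor_vec creation_fock_vec fock_vec_in_l2)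
    have "cinner P P = cinner ?p ?p"
      using p Sp sub P inner[of ?p P] by auto
    then have "(norm P)\<^sup>2 = (norm ?p)\<^sup>2" unfolding cinner_self by (simp only: of_real_eq_iff)
    then show "norm P = norm ?p" by (simp add: power2_eq_iff_nonneg)
  qed
qed

text \<open>Each of the \<open>n i\<close> letters that can be prefixed contributes at least the
  whole trace at degree \<open>q\<close>. The factor \<open>n i\<close> is the one by which the
  number of words grows, so the quotients do not decrease.\<close>

lemma degree_trace_Suc:
  assumes i: "i \<in> {1..k}"
  shows "real (n i) * degree_trace X k n M q \<le> degree_trace X k n M (q(i := Suc (q i)))"
proof -
  let ?t = "\<lambda>\<alpha>. \<Sum>x\<in>X. (norm (cproj {F. Rep_ell2 F \<in> M} (tensor_vec \<alpha> x)))\<^sup>2"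
  have "real (n i) * degree_trace X k n M q = (\<Sum>j\<in>{1..n i}. \<Sum>\<alpha>\<in>words_of_degree k n q. ?t \<alpha>)"
    by (simp add: degree_trace_def)
  also have "\<dots> \<le> (\<Sum>j\<in>{1..n i}. \<Sum>\<alpha>\<in>words_of_degree k n q. ?t (\<alpha>(i := j # \<alpha> i)))"
    by (intro sum_mono power_mono norm_cproj_tensor_vec_mono i) (auto simp: words_of_degree_def)
  also have "\<dots> = degree_trace X k n M (q(i := Suc (q i)))"
    unfolding degree_trace_def by (rule sum_words_of_degree_Suc[OF i, symmetric])
  finally show ?thesis .
qed

lemma degree_trace_le:
  assumes "orthonormal X"
  shows "degree_trace X k n M q \<le> real (card (words_of_degree k n q)) * real (card X)"
proof -
  have cl: "closed_subspace (multiwords k n) M" using M by (simp add: invariant_subspace_def)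
  note M' = csubspace_Rep_ell2[OF cl] complete_Rep_ell2[OF cl complete]
  have "(norm (cproj {F. Rep_ell2 F \<in> M} (tensor_vec \<alpha> x)))\<^sup>2 \<le> 1" if "x \<in> X" for \<alpha> x
    using norm_cproj_le[OF M', of "tensor_vec \<alpha> x"] orthonormal_norm[OF assms that]
    by (simp add: norm_tensor_vec power_le_one)
  then have "degree_trace X k n M q \<le> (\<Sum>\<alpha>\<in>words_of_degree k n q. \<Sum>x\<in>X. 1)"
    unfolding degree_trace_def by (intro sum_mono)
  then show ?thesis by simp
qed

end

lemma degree_trace_nonneg: "0 \<le> degree_trace X k n M q"
  by (simp add: degree_trace_def sum_nonneg)

definition degree_density ::
    "'e::complex_inner set \<Rightarrow> nat \<Rightarrow> (nat \<Rightarrow> nat) \<Rightarrow> ((nat \<Rightarrow> nat list) \<Rightarrow> 'e) set \<Rightarrow> (nat \<Rightarrow> nat) \<Rightarrow> real"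
  where "degree_density X k n M q = degree_trace X k n M q / real (card (words_of_degree k n q))"

section \<open>The multiplicity as a supremum\<close>

lemma
  fixes M :: "((nat \<Rightarrow> nat list) \<Rightarrow> 'e::complex_inner) set"
  assumes n: "\<forall>i\<in>{1..k}. n i \<ge> 1" and M: "invariant_subspace k n M"
    and X: "finite X" "orthonormal X" "\<And>x :: 'e. x = (\<Sum>e\<in>X. cinner x e *\<^sub>C e)"
    and complete: "complete (UNIV :: 'e set)"
  shows bdd_above_degree_density: "bdd_above (range (degree_density X k n M))"
    and subspace_multiplicity_eq_SUP:
      "subspace_multiplicity k n M = (SUP q\<in>{1..k} \<rightarrow>\<^sub>E UNIV. degree_density X k n M q)"
proof -
  let ?d = "degree_density X k n M"
  \<comment> \<open>With at least one letter in each position every degree is populated, so the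
    quotients have positive denominators.\<close>
  have pos: "card (words_of_degree k n q) > 0" for q
    using n by (auto simp: card_words_of_degree intro!: prod_pos)
  have "?d q \<le> real (card X)" for q
    using degree_trace_le[OF M complete X(2), of q] pos[of q]
    by (simp add: degree_density_def divide_le_eq mult.commute)
  then show bdd: "bdd_above (range ?d)" by (intro bdd_aboveI2)
  have "(\<lambda>r. (1 / real ((r + k) choose k)) * (\<Sum>q\<in>degrees_upto k r. ?d q))
    \<longlonglongrightarrow> (SUP q\<in>{1..k} \<rightarrow>\<^sub>E UNIV. ?d q)"
  proof (rule degrees_upto_average_tendsto_SUP)
    fix q i assume i: "i \<in> {1..k}"
    let ?q = "q(i := Suc (q i))"
    have "n i > 0" using n i by (metis less_le_trans zero_less_one)
    \<comment> \<open>The quotient is expanded by \<open>n i\<close> to give it the denominator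
      belonging to \<open>?q\<close>; the comparison is then one of numerators.\<close>
    then have "?d q = real (n i) * degree_trace X k n M q / real (card (words_of_degree k n ?q))"
      unfolding card_words_of_degree_Suc[OF i] degree_density_def by simp
    also have "\<dots> \<le> ?d ?q"
      unfolding degree_density_def using degree_trace_Suc[OF M complete i] by (intro divide_right_mono) auto
    finally show "?d q \<le> ?d ?q" .
  next
    show "bdd_above (?d ` ({1..k} \<rightarrow>\<^sub>E UNIV))" using bdd by (rule bdd_above_mono) auto
  qed (simp add: degree_density_def degree_trace_nonneg)
  moreover have "closed_subspace (multiwords k n) M" using M by (simp add: invariant_subspace_def)
  ultimately show "subspace_multiplicity k n M = (SUP q\<in>{1..k} \<rightarrow>\<^sub>E UNIV. ?d q)"
    unfolding subspace_multiplicity_def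
    by (intro limI) (simp add: trace_op_degree_proj[OF _ complete X] trace_op_degree_proj_scalar
        degree_density_def degrees_upto_def)
qed

section \<open>Weak operator continuity and lower semicontinuity\<close>

text \<open>Weak convergence is tested on each elementary tensor in both arguments, where the matrix
  coefficient is a squared norm of a projection; only finitely many words occur at a given
  degree.\<close>

lemma degree_density_tendsto:
  fixes M :: "((nat \<Rightarrow> nat list) \<Rightarrow> 'e::complex_inner) set"
  assumes M: "closed_subspace (multiwords k n) M"
    and Mm: "\<And>m. m \<ge> 1 \<Longrightarrow> closed_subspace (multiwords k n) (Mm m)"
    and complete: "complete (UNIV :: 'e set)"
    and wot: "wot_tendsto (multiwords k n) (\<lambda>m. orth_proj (multiwords k n) (Mm m)) (orth_proj (multiwords k n) M)"
  shows "(\<lambda>m. degree_density X k n (Mm m) q) \<longlonglongrightarrow> degree_density X k n M q"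
proof -
  let ?W = "multiwords k n"
  let ?c = "\<lambda>M \<alpha> x. (norm (cproj {F. Rep_ell2 F \<in> M} (tensor_vec \<alpha> x)))\<^sup>2"
  have "(\<lambda>m. ?c (Mm m) \<alpha> x) \<longlonglongrightarrow> ?c M \<alpha> x" if \<alpha>: "\<alpha> \<in> ?W" for \<alpha> and x :: 'e
  proof -
    let ?f = "fock_vec \<alpha> x"
    have f: "?f \<in> l2 ?W" using \<alpha> by (rule fock_vec_in_l2)
    have eq: "l2_inner ?W (orth_proj ?W N ?f) ?f = of_real (?c N \<alpha> x)" if N: "closed_subspace ?W N" for N
    proof -
      note N' = csubspace_Rep_ell2[OF N] complete_Rep_ell2[OF N complete]
      have "Rep_ell2 (cproj {F. Rep_ell2 F \<in> N} (tensor_vec \<alpha> x)) \<in> l2 ?W"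
        using cproj_in[OF N'] N by (auto simp: closed_subspace_def)
      then show ?thesis
        using orth_proj_Rep_ell2[OF N complete, of "tensor_vec \<alpha> x"] f
          l2_inner_Rep_ell2[of _ ?W "tensor_vec \<alpha> x"] cinner_cproj_self[OF N', of "tensor_vec \<alpha> x"]
        by (simp add: Rep_tensor_vec)
    qed
    have "(\<lambda>m. l2_inner ?W (orth_proj ?W (Mm m) ?f) ?f) \<longlonglongrightarrow> of_real (?c M \<alpha> x)"
      using wot f unfolding wot_tendsto_def eq[OF M, symmetric] by blast
    then have "(\<lambda>m. Re (l2_inner ?W (orth_proj ?W (Mm m) ?f) ?f)) \<longlonglongrightarrow> Re (of_real (?c M \<alpha> x))"
      by (rule tendsto_Re)
    \<comment> \<open>Nothing is assumed about \<open>Mm 0\<close>, so the identification of the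
      coefficients holds only from index 1 on.\<close>
    moreover have "eventually (\<lambda>m. Re (l2_inner ?W (orth_proj ?W (Mm m) ?f) ?f) = ?c (Mm m) \<alpha> x) sequentially"
      using eventually_ge_at_top[of 1] by eventually_elim (simp add: eq[OF Mm])
    ultimately show ?thesis by (auto intro: Lim_transform_eventually)
  qed
  then show ?thesis
    unfolding degree_density_def degree_trace_def
    unfolding divide_inverse by (intro tendsto_mult tendsto_const tendsto_sum) (auto simp: words_of_degree_def)
qed

theorem theorem4p5:
  fixes k :: nat and n :: "nat \<Rightarrow> nat"
    and M :: "((nat \<Rightarrow> nat list) \<Rightarrow> 'e::complex_inner) set"
    and Mm :: "nat \<Rightarrow> ((nat \<Rightarrow> nat list) \<Rightarrow> 'e) set"
  assumes "k \<ge> 1"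
    and "\<forall>i\<in>{1..k}. n i \<ge> 1"
    and "finite_dim_complex TYPE('e)"
    and "invariant_subspace k n M"
    and "\<forall>m\<ge>1. invariant_subspace k n (Mm m)"
    and "wot_tendsto (multiwords k n) (\<lambda>m. orth_proj (multiwords k n) (Mm m))
           (orth_proj (multiwords k n) M)"
  shows "liminf (\<lambda>m. ereal (subspace_multiplicity k n (Mm m))) \<ge> ereal (subspace_multiplicity k n M)"
proof -
  obtain X :: "'e set" where X: "finite X" "orthonormal X" "\<And>x. x = (\<Sum>e\<in>X. cinner x e *\<^sub>C e)"
    using ex_finite_orthonormal_basis[OF assms(3)] by blast
  note complete = complete_UNIV_finite_dim_complex[OF assms(3)]
  note SUP = subspace_multiplicity_eq_SUP[OF assms(2) _ X complete]
  let ?Q = "{1..k} \<rightarrow>\<^sub>E (UNIV :: nat set)"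
  have bdd: "bdd_above (degree_density X k n N ` ?Q)" if "invariant_subspace k n N" for N
    using bdd_above_degree_density[OF assms(2) that X complete] by (rule bdd_above_mono) auto
  have lim: "(\<lambda>m. degree_density X k n (Mm m) q) \<longlonglongrightarrow> degree_density X k n M q" for q
    using assms(4,5,6) complete by (intro degree_density_tendsto) (auto simp: invariant_subspace_def)
  \<comment> \<open>The inferior limit is bounded below by testing every extended real
    \<open>y\<close> strictly below the multiplicity of \<open>M\<close>. Only real \<open>y\<close>
    need an argument: minus infinity lies below every real value, and plus infinity is
    excluded.\<close>
  have "eventually (\<lambda>m. y < ereal (subspace_multiplicity k n (Mm m))) sequentially"
    if y: "y < ereal (subspace_multiplicity k n M)" for y
  proof (cases y)
    case (real s)
    then have "s < (SUP q\<in>?Q. degree_density X k n M q)" using y SUP[OF assms(4)] by simp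
    \<comment> \<open>The degree \<open>q\<close> is chosen from \<open>M\<close> alone and stays
      fixed while \<open>m\<close> varies, so convergence at each single degree suffices; no
      uniformity over degrees is required.\<close>
    then obtain q where q: "q \<in> ?Q" "s < degree_density X k n M q"
      using less_cSUP_iff[OF _ bdd[OF assms(4)], of s] by (metis PiE_eq_empty_iff UNIV_not_empty)
    have "eventually (\<lambda>m. s < degree_density X k n (Mm m) q) sequentially"
      using lim q(2) by (rule order_tendstoD)
    then show ?thesis
      using eventually_ge_at_top[of 1]
    proof eventually_elim
      case (elim m)
      then have inv: "invariant_subspace k n (Mm m)" using assms(5) by blast
      have "degree_density X k n (Mm m) q \<le> subspace_multiplicity k n (Mm m)"
        unfolding SUP[OF inv] by (rule cSUP_upper[OF q(1) bdd[OF inv]])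
      with elim(1) real show ?case by simp
    qed
  qed (use y in auto)
  then show ?thesis by (simp add: le_Liminf_iff)
qed

end
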